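(* Suppose $(X,d)$ is a geodesic metric space equipped with a coarse $r$-median structure with parameters $(F,\Lambda,\delta_0,\lambda,\Psi)$ that is $\Psi$-affine, i.e. the function $(\delta,D)\mapsto\Psi(\delta,D)$ is affine in both coordinates. Then any asymptotic cone of $X$ admits an $r$-median structure.
   Context: Coarse medians. Let $(X,d)$ be a metric space and $r\ge1$. $\mathcal{N}_s(A)=\{x: d(x,A)<s\}$ for $s>0$, $\mathcal{N}_0(A)=A$; $d^{\rm H}$ is Hausdorff distance; $\mathrm{diam}(\emptyset)=0$; $\mathcal{P}(X)$ is the power set. A coarse $r$-filling on $X$ is a pair $(F,\Lambda)$ with $F=\{F_i:X^{i+1}\to\mathcal{P}(X)\}_{i=0,\dots,r}$ and $\Lambda:[0,\infty)\to[0,\infty)$ non-decreasing such that for all $k\in\{0,\dots,r\}$ and $a_0,\dots,a_k\in X$: (F0) $d^{\rm H}(a_0,F_0(a_0))\le\Lambda(0)$; (F1) (for $k\ge1$) $F_{k-1}(a_0,\dots,\widehat{a_i},\dots,a_k)\subseteq\mathcal{N}_{\Lambda(0)}(F_k(a_0,\dots,a_k))$ for all $i$; (F2) $d^{\rm H}(F_k(a_0,\dots,a_k),F_k(a_{\sigma(0)},\dots,a_{\sigma(k)}))\le\Lambda(0)$ for every permutation $\sigma$; (F3) for $k\le r-1$, $F_{k+1}(a_0,\dots,a_k,a_k)\subseteq\mathcal{N}_{\Lambda(0)}(F_k(a_0,\dots,a_k))$; (F4) for $R\ge0$, if $x\in\mathcal{N}_R(F_k(a_0,\dots,a_k))$ then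 $F_k(a_0,\dots,a_{j-1},x,a_{j+1},\dots,a_k)\subseteq\mathcal{N}_{\Lambda(R)}(F_k(a_0,\dots,a_k))$ for all $j$. It is an $r$-filling if $\Lambda(0)=0$. For $I=\{j_1<\dots<j_p\}$ write $F_{|I|-1}(a_i:i\in I)=F_{p-1}(a_{j_1},\dots,a_{j_p})$. For $\delta,D\ge0$, $(a_0,\dots,a_{r+1})\in X^{r+2}$ is $(\delta,D)$-generic if for any non-empty proper subsets $I_1,\dots,I_q\subset\{0,\dots,r+1\}$ with $\bigcap_jI_j=\emptyset$ and $\mathrm{diam}\big(\bigcap_{j}\mathcal{N}_\delta(F_{|I_j|-1}(a_i:i\in I_j))\big)>D$ one has $|I_1|=\dots=|I_q|=r+1$. A coarse $r$-median structure on $(X,d)$ with parameters $(F,\Lambda,\delta_0,\lambda,\Psi)$ consists of a coarse $r$-filling $(F,\Lambda)$, a constant $\delta_0\ge0$, a non-constant affine $\lambda:[\delta_0,\infty)\to[0,\infty)$ (i.e. $\lambda(\delta)=a(\delta-\delta_0)+b$, $a>0$, $b\ge0$), and $\Psi:[\delta_0,\infty)^2\to[0,\infty)$ non-decreasing in both entries such that: (CM1) for all $a_0,\dots,a_{r+1}\in X$, $\bigcap_{j=0}^{r+1}\mathcal{N}_{\lambda(\delta_0)}(F_r(a_0,\dots,\widehat{a_j},\dots,a_{r+1}))\ne\emptyset$; (CM2) for all $\delta,D\ge\delta_0$ and every $(\delta,D)$-generic $(a_0,\dots,a_{r+1})$, $\mathrm{diam}\big(\bigcap_{j=0}^{r+1}\mathcal{N}_{\lambda(\delta)}(F_r(a_0,\dots,\widehat{a_j},\dots,a_{r+1}))\big)\le\Psi(\delta,D)$.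 It is an $r$-median structure if moreover $(F,\Lambda)$ is an $r$-filling, $\delta_0=\Psi(0,0)=0$, and $\lambda$ is linear ($\lambda(\delta)=a\delta$). "$\Psi$ is affine in both coordinates" means $\Psi(\delta,D)=B\delta+CD+E$ for constants $B,C,E$. Asymptotic cones. Given a non-principal ultrafilter $\omega$ on $\mathbb{N}$, a base point $o\in X$, and positive reals $\nu_n\to\infty$, let $X^0_\omega$ be the set of sequences $(a_n)\in X^{\mathbb{N}}$ with $\omega\text{-}\lim d(a_n,o)/\nu_n<\infty$, with pseudo-distance $d_\omega((a_n),(b_n))=\omega\text{-}\lim d(a_n,b_n)/\nu_n$. The asymptotic cone is the quotient metric space obtained by identifying sequences at $d_\omega$-distance $0$. *)

theory Defs
  imports "HOL-Analysis.Analysis" "HOL-Combinatorics.Permutations"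
begin

section \<open>Metric notions with values in \<open>[0,\<infinity>]\<close>\<close>

text \<open>Suprema and infima are taken in \<^typ>\<open>ennreal\<close>: a diameter may be infinite, the diameter of the
  empty set is 0, and the distance from a point to the empty set is infinite.\<close>

definition point_dist :: "('a \<Rightarrow> 'a \<Rightarrow> real) \<Rightarrow> 'a \<Rightarrow> 'a set \<Rightarrow> ennreal" where
  "point_dist d x A = (INF a\<in>A. ennreal (d x a))"

definition hausdorff_dist :: "('a \<Rightarrow> 'a \<Rightarrow> real) \<Rightarrow> 'a set \<Rightarrow> 'a set \<Rightarrow> ennreal" where
  "hausdorff_dist d A B = max (SUP a\<in>A. point_dist d a B) (SUP b\<in>B. point_dist d b A)"

definition ediam :: "('a \<Rightarrow> 'a \<Rightarrow> real) \<Rightarrow> 'a set \<Rightarrow> ennreal" where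
  "ediam d A = (SUP x\<in>A. SUP y\<in>A. ennreal (d x y))"

definition nbhd :: "'a set \<Rightarrow> ('a \<Rightarrow> 'a \<Rightarrow> real) \<Rightarrow> real \<Rightarrow> 'a set \<Rightarrow> 'a set" where
  "nbhd M d s A = (if s = 0 then A else {x \<in> M. point_dist d x A < ennreal s})"

definition geodesic_space :: "'a set \<Rightarrow> ('a \<Rightarrow> 'a \<Rightarrow> real) \<Rightarrow> bool" where
  "geodesic_space M d \<longleftrightarrow> Metric_space M d \<and>
    (\<forall>x\<in>M. \<forall>y\<in>M. \<exists>\<gamma>::real \<Rightarrow> 'a.
      \<gamma> ` {0..d x y} \<subseteq> M \<and> \<gamma> 0 = x \<and> \<gamma> (d x y) = y \<and>
      (\<forall>s\<in>{0..d x y}. \<forall>t\<in>{0..d x y}. d (\<gamma> s) (\<gamma> t) = \<bar>s - t\<bar>))"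


section \<open>Coarse fillings\<close>

text \<open>A tuple \<open>(a\<^sub>0,\<dots>,a\<^sub>k)\<close> is a list of length \<open>k + 1\<close>. The family
  \<open>F\<^sub>0,\<dots>,F\<^sub>r\<close> is encoded as a single function on lists: \<open>F\<^sub>k\<close> is its restriction to the
  lists of length \<open>k + 1\<close>, and its values on lists of length 0 or greater than \<open>r + 1\<close> play
  no role. The tuple \<open>(a\<^sub>i : i \<in> I)\<close> in increasing order of the indices is \<open>nths a I\<close>.\<close>

definition tuples :: "nat \<Rightarrow> 'a set \<Rightarrow> 'a list set" where
  "tuples m M = {a. length a = m \<and> set a \<subseteq> M}"

definition coarse_filling ::
  "nat \<Rightarrow> 'a set \<Rightarrow> ('a \<Rightarrow> 'a \<Rightarrow> real) \<Rightarrow> ('a list \<Rightarrow> 'a set) \<Rightarrow> (real \<Rightarrow> real) \<Rightarrow> bool" where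
  "coarse_filling r M d F \<Lambda> \<longleftrightarrow>
    (\<forall>k\<le>r. \<forall>a\<in>tuples (k + 1) M. F a \<subseteq> M) \<and>
    (\<forall>R\<ge>0. 0 \<le> \<Lambda> R) \<and> mono_on {0..} \<Lambda> \<and>
    \<comment> \<open>F0\<close>
    (\<forall>x\<in>M. hausdorff_dist d {x} (F [x]) \<le> ennreal (\<Lambda> 0)) \<and>
    \<comment> \<open>F1\<close>
    (\<forall>k\<in>{1..r}. \<forall>a\<in>tuples (k + 1) M. \<forall>i\<le>k.
      F (nths a ({0..k} - {i})) \<subseteq> nbhd M d (\<Lambda> 0) (F a)) \<and>
    \<comment> \<open>F2\<close>
    (\<forall>k\<le>r. \<forall>a\<in>tuples (k + 1) M. \<forall>\<sigma>. \<sigma> permutes {0..k} \<longrightarrow>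
      hausdorff_dist d (F a) (F (permute_list \<sigma> a)) \<le> ennreal (\<Lambda> 0)) \<and>
    \<comment> \<open>F3\<close>
    (\<forall>k<r. \<forall>a\<in>tuples (k + 1) M. F (a @ [last a]) \<subseteq> nbhd M d (\<Lambda> 0) (F a)) \<and>
    \<comment> \<open>F4\<close>
    (\<forall>k\<le>r. \<forall>a\<in>tuples (k + 1) M. \<forall>R\<ge>0. \<forall>x\<in>nbhd M d R (F a). \<forall>j\<le>k.
      F (a[j := x]) \<subseteq> nbhd M d (\<Lambda> R) (F a))"

definition filling ::
  "nat \<Rightarrow> 'a set \<Rightarrow> ('a \<Rightarrow> 'a \<Rightarrow> real) \<Rightarrow> ('a list \<Rightarrow> 'a set) \<Rightarrow> (real \<Rightarrow> real) \<Rightarrow> bool" where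
  "filling r M d F \<Lambda> \<longleftrightarrow> coarse_filling r M d F \<Lambda> \<and> \<Lambda> 0 = 0"


section \<open>Coarse medians\<close>

definition generic ::
  "nat \<Rightarrow> 'a set \<Rightarrow> ('a \<Rightarrow> 'a \<Rightarrow> real) \<Rightarrow> ('a list \<Rightarrow> 'a set) \<Rightarrow> real \<Rightarrow> real \<Rightarrow> 'a list \<Rightarrow> bool" where
  "generic r M d F \<delta> D a \<longleftrightarrow> a \<in> tuples (r + 2) M \<and>
    (\<forall>q\<ge>1. \<forall>I :: nat \<Rightarrow> nat set.
      (\<forall>j\<in>{1..q}. I j \<noteq> {} \<and> I j \<subset> {0..r + 1}) \<and>
      (\<Inter>j\<in>{1..q}. I j) = {} \<and>
      ediam d (\<Inter>j\<in>{1..q}. nbhd M d \<delta> (F (nths a (I j)))) > ennreal D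
      \<longrightarrow> (\<forall>j\<in>{1..q}. card (I j) = r + 1))"

text \<open>The intersection of the \<open>s\<close>-neighbourhoods of the faces \<open>F\<^sub>r(a\<^sub>0,\<dots>,a\<^bsub>r+1\<^esub>)\<close>,
  the entry \<open>a\<^sub>j\<close> being omitted in the \<open>j\<close>-th face.\<close>

definition face_intersection ::
  "nat \<Rightarrow> 'a set \<Rightarrow> ('a \<Rightarrow> 'a \<Rightarrow> real) \<Rightarrow> ('a list \<Rightarrow> 'a set) \<Rightarrow> real \<Rightarrow> 'a list \<Rightarrow> 'a set" where
  "face_intersection r M d F s a =
    (\<Inter>j\<in>{0..r + 1}. nbhd M d s (F (nths a ({0..r + 1} - {j}))))"

text \<open>The functions \<open>\<lambda>\<close> and \<open>\<Psi>\<close> are total on the reals; only their values on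
  \<open>[\<delta>\<^sub>0,\<infinity>)\<close> and its square are constrained.\<close>

definition coarse_median_structure ::
  "nat \<Rightarrow> 'a set \<Rightarrow> ('a \<Rightarrow> 'a \<Rightarrow> real) \<Rightarrow> ('a list \<Rightarrow> 'a set) \<Rightarrow> (real \<Rightarrow> real) \<Rightarrow>
    real \<Rightarrow> (real \<Rightarrow> real) \<Rightarrow> (real \<Rightarrow> real \<Rightarrow> real) \<Rightarrow> bool" where
  "coarse_median_structure r M d F \<Lambda> \<delta>0 lam \<Psi> \<longleftrightarrow>
    Metric_space M d \<and> coarse_filling r M d F \<Lambda> \<and> 0 \<le> \<delta>0 \<and>
    (\<exists>\<alpha>>0. \<exists>\<beta>\<ge>0. \<forall>\<delta>\<ge>\<delta>0. lam \<delta> = \<alpha> * (\<delta> - \<delta>0) + \<beta>) \<and>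
    (\<forall>\<delta>\<ge>\<delta>0. \<forall>D\<ge>\<delta>0. 0 \<le> \<Psi> \<delta> D) \<and>
    (\<forall>D\<ge>\<delta>0. mono_on {\<delta>0..} (\<lambda>\<delta>. \<Psi> \<delta> D)) \<and>
    (\<forall>\<delta>\<ge>\<delta>0. mono_on {\<delta>0..} (\<lambda>D. \<Psi> \<delta> D)) \<and>
    \<comment> \<open>CM1\<close>
    (\<forall>a\<in>tuples (r + 2) M. face_intersection r M d F (lam \<delta>0) a \<noteq> {}) \<and>
    \<comment> \<open>CM2\<close>
    (\<forall>\<delta>\<ge>\<delta>0. \<forall>D\<ge>\<delta>0. \<forall>a. generic r M d F \<delta> D a \<longrightarrow>
      ediam d (face_intersection r M d F (lam \<delta>) a) \<le> ennreal (\<Psi> \<delta> D))"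

definition median_structure ::
  "nat \<Rightarrow> 'a set \<Rightarrow> ('a \<Rightarrow> 'a \<Rightarrow> real) \<Rightarrow> ('a list \<Rightarrow> 'a set) \<Rightarrow> (real \<Rightarrow> real) \<Rightarrow>
    real \<Rightarrow> (real \<Rightarrow> real) \<Rightarrow> (real \<Rightarrow> real \<Rightarrow> real) \<Rightarrow> bool" where
  "median_structure r M d F \<Lambda> \<delta>0 lam \<Psi> \<longleftrightarrow>
    coarse_median_structure r M d F \<Lambda> \<delta>0 lam \<Psi> \<and> filling r M d F \<Lambda> \<and>
    \<delta>0 = 0 \<and> \<Psi> 0 0 = 0 \<and> (\<exists>\<alpha>. \<forall>\<delta>\<ge>0. lam \<delta> = \<alpha> * \<delta>)"

definition affine_in_both :: "real \<Rightarrow> (real \<Rightarrow> real \<Rightarrow> real) \<Rightarrow> bool" where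
  "affine_in_both \<delta>0 \<Psi> \<longleftrightarrow> (\<exists>B C E. \<forall>\<delta>\<ge>\<delta>0. \<forall>D\<ge>\<delta>0. \<Psi> \<delta> D = B * \<delta> + C * D + E)"


section \<open>Asymptotic cones\<close>

definition nonprincipal_ultrafilter :: "nat filter \<Rightarrow> bool" where
  "nonprincipal_ultrafilter \<omega> \<longleftrightarrow> \<omega> \<noteq> bot \<and>
    (\<forall>P. eventually P \<omega> \<or> eventually (\<lambda>n. \<not> P n) \<omega>) \<and>
    (\<forall>m. \<not> eventually (\<lambda>n. n = m) \<omega>)"

text \<open>A limit along \<open>\<omega>\<close> of a nonnegative sequence always exists in \<open>[0,\<infinity>]\<close>; it is finite
  iff the sequence converges along \<open>\<omega>\<close> to a real number.\<close>

definition cone_seqs ::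
  "'a set \<Rightarrow> ('a \<Rightarrow> 'a \<Rightarrow> real) \<Rightarrow> nat filter \<Rightarrow> 'a \<Rightarrow> (nat \<Rightarrow> real) \<Rightarrow> (nat \<Rightarrow> 'a) set" where
  "cone_seqs M d \<omega> p \<nu> =
    {a. range a \<subseteq> M \<and> (\<exists>l::real. ((\<lambda>n. d (a n) p / \<nu> n) \<longlongrightarrow> l) \<omega>)}"

definition cone_pdist ::
  "('a \<Rightarrow> 'a \<Rightarrow> real) \<Rightarrow> nat filter \<Rightarrow> (nat \<Rightarrow> real) \<Rightarrow> (nat \<Rightarrow> 'a) \<Rightarrow> (nat \<Rightarrow> 'a) \<Rightarrow> real" where
  "cone_pdist d \<omega> \<nu> a b = Lim \<omega> (\<lambda>n. d (a n) (b n) / \<nu> n)"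

definition asymptotic_cone ::
  "'a set \<Rightarrow> ('a \<Rightarrow> 'a \<Rightarrow> real) \<Rightarrow> nat filter \<Rightarrow> 'a \<Rightarrow> (nat \<Rightarrow> real) \<Rightarrow> (nat \<Rightarrow> 'a) set set" where
  "asymptotic_cone M d \<omega> p \<nu> = cone_seqs M d \<omega> p \<nu> //
    {(a, b). a \<in> cone_seqs M d \<omega> p \<nu> \<and> b \<in> cone_seqs M d \<omega> p \<nu> \<and> cone_pdist d \<omega> \<nu> a b = 0}"

text \<open>The distance between two classes, computed on arbitrary representatives. The value 0 outside
  the cone only serves the requirement of \<^locale>\<open>Metric_space\<close> that the distance be nonnegative
  and symmetric on the whole type.\<close>

definition cone_dist ::
  "'a set \<Rightarrow> ('a \<Rightarrow> 'a \<Rightarrow> real) \<Rightarrow> nat filter \<Rightarrow> 'a \<Rightarrow> (nat \<Rightarrow> real) \<Rightarrow>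
    (nat \<Rightarrow> 'a) set \<Rightarrow> (nat \<Rightarrow> 'a) set \<Rightarrow> real" where
  "cone_dist M d \<omega> p \<nu> A B =
    (if A \<in> asymptotic_cone M d \<omega> p \<nu> \<and> B \<in> asymptotic_cone M d \<omega> p \<nu>
     then cone_pdist d \<omega> \<nu> (SOME a. a \<in> A) (SOME b. b \<in> B) else 0)"

end

theory Submission
  imports Defs
begin

text \<open>The filling of the cone is the ultralimit of the rescaled sets \<open>F(a\<^sub>0,\<dots>,a\<^sub>k)\<close>, so bounded
  errors disappear. The control function may grow arbitrarily fast, and only its affine growth survives
  rescaling: in a geodesic space (F4) can be applied along unit steps, each costing a constant, so \<open>\<Lambda>\<close>
  can be replaced by an affine function. For (CM2) there are finitely many families of index sets, hence
  a failure of genericity along \<open>\<omega>\<close> is witnessed by a single family and passes to the cone.\<close>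

section \<open>Neighbourhoods and diameters\<close>

text \<open>The recurring obstacle is that neighbourhoods are open for \<open>s > 0\<close> and
  equal to the set for \<open>s = 0\<close>, while limits along \<omega> keep only weak
  inequalities. This is the source of the alternative
  \<open>l < \<delta> \<or> l = 0 \<and> \<delta> = 0\<close>, and of the transfer of genericity to
  scales whose limit is strictly below \<delta> and diameter bounds whose limit is strictly above
  \<open>D\<close>. The excess over \<open>D\<close> is made arbitrarily small at the end; since
  \<Psi> is affine, its rescaled values converge and depend continuously on that excess. A second
  obstacle is that sequences chosen in the sets \<open>F\<close> must stay at distance O(\<nu>) from
  the base point, which no axiom states. (F0) and (F3) settle constant tuples, and the affine form
  of (F4) carries the bound to all tuples.\<close>

lemma (in Metric_space) mem_nbhd_iff:
  assumes "A \<subseteq> M" "0 \<le> s"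
  shows "x \<in> nbhd M d s A \<longleftrightarrow> x \<in> M \<and> (\<exists>y\<in>A. d x y < s \<or> s = 0 \<and> x = y)"
proof (cases "s = 0")
  case True
  then show ?thesis using assms nonneg by (auto simp: nbhd_def less_le_not_le)
next
  case False
  then show ?thesis using assms
    by (auto simp: nbhd_def point_dist_def INF_less_iff ennreal_less_iff)
qed

lemma (in Metric_space) nbhd_subset: "A \<subseteq> M \<Longrightarrow> nbhd M d s A \<subseteq> M"
  by (auto simp: nbhd_def)

lemma (in Metric_space) nbhdD:
  assumes "x \<in> nbhd M d s A" "A \<subseteq> M" "0 \<le> s"
  obtains y where "y \<in> A" "d x y \<le> s"
  using assms by (auto simp: mem_nbhd_iff intro: less_imp_le)

lemma (in Metric_space) nbhdI:
  "\<lbrakk>x \<in> M; y \<in> A; d x y < s\<rbrakk> \<Longrightarrow> x \<in> nbhd M d s A"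
  using nonneg[of x y] by (cases "s = 0") (auto simp: nbhd_def point_dist_def INF_less_iff ennreal_less_iff)

lemma (in Metric_space) ediam_le_iff:
  "0 \<le> c \<Longrightarrow> ediam d A \<le> ennreal c \<longleftrightarrow> (\<forall>x\<in>A. \<forall>y\<in>A. d x y \<le> c)"
  by (simp add: ediam_def SUP_le_iff)

lemma (in Metric_space) less_ediam_iff:
  "0 \<le> c \<Longrightarrow> ennreal c < ediam d A \<longleftrightarrow> (\<exists>x\<in>A. \<exists>y\<in>A. c < d x y)"
  by (simp add: ediam_def less_SUP_iff ennreal_less_iff)

lemma (in Metric_space) hausdorff_distD:
  assumes "hausdorff_dist d A B \<le> ennreal c" "0 \<le> c"
  shows "a \<in> A \<Longrightarrow> \<exists>b\<in>B. d a b \<le> c + 1" and "b \<in> B \<Longrightarrow> \<exists>a\<in>A. d b a \<le> c + 1"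
proof -
  have lt: "ennreal c < ennreal (c + 1)"
    using assms(2) by (simp add: ennreal_less_iff)
  {
    assume "a \<in> A"
    then have "point_dist d a B \<le> ennreal c"
      using assms(1) by (auto simp: hausdorff_dist_def SUP_le_iff)
    then have "point_dist d a B < ennreal (c + 1)" using lt by order
    then show "\<exists>b\<in>B. d a b \<le> c + 1"
      by (auto simp: point_dist_def INF_less_iff ennreal_less_iff intro: less_imp_le)
  next
    assume "b \<in> B"
    then have "point_dist d b A \<le> ennreal c"
      using assms(1) by (auto simp: hausdorff_dist_def SUP_le_iff)
    then have "point_dist d b A < ennreal (c + 1)" using lt by order
    then show "\<exists>a\<in>A. d b a \<le> c + 1"
      by (auto simp: point_dist_def INF_less_iff ennreal_less_iff intro: less_imp_le)
  }
qed

lemma (in Metric_space) hausdorff_dist_same: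
  assumes "A \<subseteq> M"
  shows "hausdorff_dist d A A = 0"
proof -
  have "point_dist d a A = 0" if "a \<in> A" for a
  proof -
    have "point_dist d a A \<le> ennreal (d a a)"
      unfolding point_dist_def using that by (rule INF_lower)
    then show ?thesis using that assms by auto
  qed
  then have "(SUP a\<in>A. point_dist d a A) = (SUP a\<in>A. 0)" by (intro SUP_cong) auto
  also have "\<dots> \<le> 0" by (rule SUP_least) simp
  finally show ?thesis by (simp add: hausdorff_dist_def)
qed


section \<open>Genericity in terms of families of index sets\<close>

text \<open>All conditions in the definition depend only on the range of the indexed family
  \<open>I\<close>, so its length and repetitions can be forgotten. Unlike indexed families, sets of
  proper faces are finite in number, as the pigeonhole argument along \<omega> requires.\<close>

lemma generic_iff_family:
  "generic r M d F \<delta> D a \<longleftrightarrow> a \<in> tuples (r + 2) M \<and>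
    (\<forall>\<I>. \<I> \<noteq> {} \<and> \<I> \<subseteq> Pow {0..r + 1} - {{}, {0..r + 1}} \<and> \<Inter>\<I> = {} \<and>
      ediam d (\<Inter>J\<in>\<I>. nbhd M d \<delta> (F (nths a J))) > ennreal D \<longrightarrow> (\<forall>J\<in>\<I>. card J = r + 1))"
  (is "?L \<longleftrightarrow> ?T \<and> ?R")
proof
  assume L: ?L
  have "\<forall>J\<in>\<I>. card J = r + 1"
    if "\<I> \<noteq> {}" "\<I> \<subseteq> Pow {0..r + 1} - {{}, {0..r + 1}}" "\<Inter>\<I> = {}"
      "ediam d (\<Inter>J\<in>\<I>. nbhd M d \<delta> (F (nths a J))) > ennreal D" for \<I>
  proof -
    have fin: "finite \<I>" using that(2) by (rule finite_subset) auto
    then obtain h where "bij_betw h {1..card \<I>} \<I>"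
      using ex_bij_betw_nat_finite_1 by blast
    then have im: "h ` {1..card \<I>} = \<I>" by (simp add: bij_betw_def)
    have q: "card \<I> \<ge> 1" using that(1) fin by (simp add: Suc_le_eq card_gt_0_iff)
    have "\<forall>j\<in>{1..card \<I>}. h j \<noteq> {} \<and> h j \<subset> {0..r + 1}"
      using that(2) im by blast
    moreover have "(\<Inter>j\<in>{1..card \<I>}. h j) = {}" using im that(3) by simp
    moreover have "(\<Inter>j\<in>{1..card \<I>}. nbhd M d \<delta> (F (nths a (h j)))) = (\<Inter>J\<in>\<I>. nbhd M d \<delta> (F (nths a J)))"
    proof -
      have "(\<Inter>j\<in>{1..card \<I>}. nbhd M d \<delta> (F (nths a (h j)))) =
          (\<Inter>J\<in>h ` {1..card \<I>}. nbhd M d \<delta> (F (nths a J)))"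
        by (simp add: image_image)
      then show ?thesis by (simp only: im)
    qed
    ultimately have "\<forall>j\<in>{1..card \<I>}. card (h j) = r + 1"
      using L q that(4) unfolding generic_def by metis
    then show ?thesis using im by (metis imageE)
  qed
  then show "?T \<and> ?R" using L by (auto simp: generic_def)
next
  assume R: "?T \<and> ?R"
  have *: "\<forall>j\<in>{1..q}. card (I j) = r + 1"
    if q: "q \<ge> 1" and I: "\<forall>j\<in>{1..q}. I j \<noteq> {} \<and> I j \<subset> {0..r + 1}" "(\<Inter>j\<in>{1..q}. I j) = {}"
      "ediam d (\<Inter>j\<in>{1..q}. nbhd M d \<delta> (F (nths a (I j)))) > ennreal D" for q I
  proof -
    have "I ` {1..q} \<noteq> {}" "I ` {1..q} \<subseteq> Pow {0..r + 1} - {{}, {0..r + 1}}" "\<Inter>(I ` {1..q}) = {}"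
      using q I by auto
    moreover have "ediam d (\<Inter>J\<in>I ` {1..q}. nbhd M d \<delta> (F (nths a J))) > ennreal D"
      using I(3) by (simp add: image_image)
    ultimately have "\<forall>J\<in>I ` {1..q}. card J = r + 1" using R by metis
    then show ?thesis by blast
  qed
  show ?L unfolding generic_def
  proof (intro conjI allI impI)
    show ?T using R ..
  qed (elim conjE, rule *)
qed


section \<open>Non-principal ultrafilters\<close>

lemma ultrafilter_le_sequentially:
  assumes "nonprincipal_ultrafilter \<omega>"
  shows "\<omega> \<le> sequentially"
proof -
  have "eventually (\<lambda>n. n \<ge> N) \<omega>" for N
  proof -
    have "eventually (\<lambda>n. n \<noteq> m) \<omega>" for m
      using assms unfolding nonprincipal_ultrafilter_def by blast
    then have "eventually (\<lambda>n. \<forall>m\<in>{..<N}. n \<noteq> m) \<omega>"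
      by (intro eventually_ball_finite) auto
    then show ?thesis by eventually_elim (use not_less in auto)
  qed
  then show ?thesis
    by (force simp: le_filter_def eventually_sequentially elim: eventually_mono)
qed

text \<open>Compactness gives a cluster point \<open>l\<close>. Around it, each open
  \<open>U\<close> or its complement has eventual membership, and the complement would contradict
  clustering.\<close>

lemma ultrafilter_convergent:
  fixes f :: "nat \<Rightarrow> real"
  assumes "nonprincipal_ultrafilter \<omega>" "eventually (\<lambda>n. \<bar>f n\<bar> \<le> K) \<omega>"
  shows "\<exists>l. (f \<longlongrightarrow> l) \<omega>"
proof -
  have "\<omega> \<noteq> bot" using assms(1) by (simp add: nonprincipal_ultrafilter_def)
  then have "filtermap f \<omega> \<noteq> bot" by (simp add: filtermap_bot_iff)
  moreover have "eventually (\<lambda>x. x \<in> cball 0 K) (filtermap f \<omega>)"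
    using assms(2) by (simp add: eventually_filtermap)
  ultimately obtain l where l: "inf (nhds l) (filtermap f \<omega>) \<noteq> bot"
    using compact_cball[of "0::real" K] unfolding compact_filter by blast
  have "eventually (\<lambda>n. f n \<in> U) \<omega>" if "open U" "l \<in> U" for U
  proof (rule ccontr)
    assume "\<not> ?thesis"
    then have "eventually (\<lambda>n. f n \<notin> U) \<omega>"
      using assms(1) unfolding nonprincipal_ultrafilter_def by blast
    then have "eventually (\<lambda>x. x \<notin> U) (filtermap f \<omega>)" by (simp add: eventually_filtermap)
    moreover have "eventually (\<lambda>x. x \<in> U) (nhds l)" using that by (rule eventually_nhds_in_open)
    ultimately have "eventually (\<lambda>x. False) (inf (nhds l) (filtermap f \<omega>))"
      unfolding eventually_inf by blast
    then show False using l by (simp add: eventually_False)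
  qed
  then show ?thesis by (auto intro: topological_tendstoI)
qed

lemma ultrafilter_finite_range:
  assumes "nonprincipal_ultrafilter \<omega>" "finite S" "eventually (\<lambda>n. \<exists>s\<in>S. P s n) \<omega>"
  shows "\<exists>s\<in>S. eventually (P s) \<omega>"
proof (rule ccontr)
  assume "\<not> ?thesis"
  then have "\<forall>s\<in>S. eventually (\<lambda>n. \<not> P s n) \<omega>"
    using assms(1) unfolding nonprincipal_ultrafilter_def by blast
  then have "eventually (\<lambda>n. \<forall>s\<in>S. \<not> P s n) \<omega>"
    using assms(2) by (simp add: eventually_ball_finite_distrib)
  with assms(3) have "eventually (\<lambda>n. False) \<omega>" by eventually_elim blast
  then show False using assms(1) by (simp add: nonprincipal_ultrafilter_def eventually_False)
qed

text \<open>In (CM2) a single scale has to serve two points and all faces at once. The pointwise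
  maximum works because the maximum of finitely many limits below \<delta> is still below
  \<delta>.\<close>

lemma finite_dominating_seq:
  fixes f :: "'i \<Rightarrow> nat \<Rightarrow> real"
  assumes "finite J" "0 \<le> \<delta>"
    and "\<And>j. j \<in> J \<Longrightarrow> \<exists>l. (f j \<longlongrightarrow> l) \<omega> \<and> (l < \<delta> \<or> l = 0 \<and> \<delta> = 0)"
  shows "\<exists>g l. (g \<longlongrightarrow> l) \<omega> \<and> (l < \<delta> \<or> l = 0 \<and> \<delta> = 0) \<and> (\<forall>n. 0 \<le> g n) \<and> (\<forall>j\<in>J. \<forall>n. f j n \<le> g n)"
  using assms(1,3)
proof (induction J)
  case empty
  \<comment> \<open>Starting from the zero sequence keeps every later maximum nonnegative;
    \<open>0 \<le> \<delta>\<close> makes its limit satisfy the alternative.\<close>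
  show ?case using assms(2) by (intro exI[of _ "\<lambda>_. 0"] exI[of _ 0]) auto
next
  case (insert i J)
  have "\<exists>g l. (g \<longlongrightarrow> l) \<omega> \<and> (l < \<delta> \<or> l = 0 \<and> \<delta> = 0) \<and> (\<forall>n. 0 \<le> g n) \<and>
      (\<forall>j\<in>J. \<forall>n. f j n \<le> g n)"
    by (rule insert.IH) (rule insert.prems, simp)
  then obtain g l where g: "(g \<longlongrightarrow> l) \<omega>" "l < \<delta> \<or> l = 0 \<and> \<delta> = 0" "\<And>n. 0 \<le> g n"
    "\<And>j n. j \<in> J \<Longrightarrow> f j n \<le> g n" by metis
  obtain k where k: "(f i \<longlongrightarrow> k) \<omega>" "k < \<delta> \<or> k = 0 \<and> \<delta> = 0" using insert.prems[OF insertI1] by blast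
  have "((\<lambda>n. max (f i n) (g n)) \<longlongrightarrow> max k l) \<omega>" using k(1) g(1) by (rule tendsto_max)
  moreover have "max k l < \<delta> \<or> max k l = 0 \<and> \<delta> = 0" using g(2) k(2) by auto
  moreover have "\<forall>n. 0 \<le> max (f i n) (g n)" using g(3) by (simp add: le_max_iff_disj)
  moreover have "\<forall>j\<in>insert i J. \<forall>n. f j n \<le> max (f i n) (g n)"
    using g(4) by (auto simp: le_max_iff_disj)
  ultimately show ?case by blast
qed


section \<open>The asymptotic cone as a metric space\<close>

locale asymptotic_cone_space = Metric_space +
  fixes \<omega> :: "nat filter" and p :: 'a and \<nu> :: "nat \<Rightarrow> real"
  assumes ultra: "nonprincipal_ultrafilter \<omega>"
    and base: "p \<in> M"
    and scale_pos: "\<And>n. \<nu> n > 0"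
    and scale_tendsto: "filterlim \<nu> at_top sequentially"
begin

abbreviation "seqs \<equiv> cone_seqs M d \<omega> p \<nu>"
abbreviation "acone \<equiv> asymptotic_cone M d \<omega> p \<nu>"
abbreviation "cdist \<equiv> cone_dist M d \<omega> p \<nu>"
abbreviation "pdist \<equiv> cone_pdist d \<omega> \<nu>"

definition "cone_rel = {(a, b). a \<in> seqs \<and> b \<in> seqs \<and> pdist a b = 0}"

definition cls :: "(nat \<Rightarrow> 'a) \<Rightarrow> (nat \<Rightarrow> 'a) set" where "cls a = cone_rel `` {a}"

definition rep :: "(nat \<Rightarrow> 'a) set \<Rightarrow> nat \<Rightarrow> 'a" where "rep A = (SOME a. a \<in> A)"

lemma nontrivial [simp]: "\<omega> \<noteq> bot"
  using ultra by (simp add: nonprincipal_ultrafilter_def)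

lemma scale_nonneg: "0 \<le> \<nu> n"
  using scale_pos[of n] by simp

lemma tendsto_const_over_scale: "((\<lambda>n. c / \<nu> n) \<longlongrightarrow> 0) \<omega>"
proof -
  have "filterlim \<nu> at_top \<omega>"
    using scale_tendsto ultrafilter_le_sequentially[OF ultra] by (rule filterlim_mono[OF _ order_refl])
  then show ?thesis
    by (intro tendsto_divide_0[OF tendsto_const] filterlim_at_top_imp_at_infinity)
qed

section \<open>Sequences of linear growth and their limit distances\<close>

lemma seqs_in: "a \<in> seqs \<Longrightarrow> a n \<in> M"
  by (auto simp: cone_seqs_def)

text \<open>Bounds pass through triangle inequalities more easily than convergence does; along an
  ultrafilter the two conditions agree.\<close>

lemma seqs_iff:
  "a \<in> seqs \<longleftrightarrow> range a \<subseteq> M \<and> (\<exists>K. eventually (\<lambda>n. d (a n) p \<le> K * \<nu> n) \<omega>)"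
proof -
  have "(\<exists>l. ((\<lambda>n. d (a n) p / \<nu> n) \<longlongrightarrow> l) \<omega>) \<longleftrightarrow> (\<exists>K. eventually (\<lambda>n. d (a n) p \<le> K * \<nu> n) \<omega>)"
    (is "?L \<longleftrightarrow> ?R")
  proof
    assume ?L
    then obtain l where "((\<lambda>n. d (a n) p / \<nu> n) \<longlongrightarrow> l) \<omega>" ..
    then have "eventually (\<lambda>n. d (a n) p / \<nu> n < l + 1) \<omega>" by (rule order_tendstoD) simp
    then have "eventually (\<lambda>n. d (a n) p \<le> (l + 1) * \<nu> n) \<omega>"
      by eventually_elim (use scale_pos in \<open>simp add: divide_less_eq less_imp_le\<close>)
    then show ?R by blast
  next
    assume ?R
    then obtain K where "eventually (\<lambda>n. d (a n) p \<le> K * \<nu> n) \<omega>" ..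
    then have "eventually (\<lambda>n. \<bar>d (a n) p / \<nu> n\<bar> \<le> K) \<omega>"
      by eventually_elim (use scale_pos in \<open>simp add: divide_le_eq scale_nonneg\<close>)
    then show ?L by (rule ultrafilter_convergent[OF ultra])
  qed
  then show ?thesis by (simp add: cone_seqs_def)
qed

lemma seqs_near:
  assumes "a \<in> seqs" "range b \<subseteq> M" "eventually (\<lambda>n. d (b n) (a n) \<le> e n) \<omega>"
    and "((\<lambda>n. e n / \<nu> n) \<longlongrightarrow> l) \<omega>"
  shows "b \<in> seqs"
proof -
  obtain K where K: "eventually (\<lambda>n. d (a n) p \<le> K * \<nu> n) \<omega>" using assms(1) by (auto simp: seqs_iff)
  have "eventually (\<lambda>n. e n / \<nu> n < l + 1) \<omega>" using assms(4) by (rule order_tendstoD) simp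
  with K assms(3) have "eventually (\<lambda>n. d (b n) p \<le> (K + (l + 1)) * \<nu> n) \<omega>"
  proof eventually_elim
    case (elim n)
    have "d (b n) p \<le> d (b n) (a n) + d (a n) p"
      using assms(1,2) base seqs_in by (intro triangle) auto
    moreover have "e n \<le> (l + 1) * \<nu> n"
      using elim(3) scale_pos[of n] by (simp add: divide_less_eq less_imp_le)
    ultimately show ?case using elim by (simp add: algebra_simps)
  qed
  then show ?thesis using assms(2) by (auto simp: seqs_iff)
qed

text \<open>\<open>Lim\<close> is informative only when a limit exists. The detour through the base
  point bounds the quotients, and \<omega> then makes them converge.\<close>

lemma tendsto_pdist:
  assumes "a \<in> seqs" "b \<in> seqs"
  shows "((\<lambda>n. d (a n) (b n) / \<nu> n) \<longlongrightarrow> pdist a b) \<omega>"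
proof -
  obtain K where K: "eventually (\<lambda>n. d (a n) p \<le> K * \<nu> n) \<omega>" using assms(1) by (auto simp: seqs_iff)
  obtain L where L: "eventually (\<lambda>n. d (b n) p \<le> L * \<nu> n) \<omega>" using assms(2) by (auto simp: seqs_iff)
  have "eventually (\<lambda>n. \<bar>d (a n) (b n) / \<nu> n\<bar> \<le> K + L) \<omega>" using K L
  proof eventually_elim
    case (elim n)
    have "d (a n) (b n) \<le> d (a n) p + d (b n) p"
      using triangle[of "a n" p "b n"] assms base seqs_in commute by simp
    then show ?case using elim scale_pos[of n] by (simp add: divide_le_eq scale_nonneg distrib_right)
  qed
  from ultrafilter_convergent[OF ultra this]
  obtain l where l: "((\<lambda>n. d (a n) (b n) / \<nu> n) \<longlongrightarrow> l) \<omega>" ..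
  then have "pdist a b = l" unfolding cone_pdist_def by (intro tendsto_Lim) auto
  with l show ?thesis by simp
qed

lemma pdist_le:
  assumes "a \<in> seqs" "b \<in> seqs" "eventually (\<lambda>n. d (a n) (b n) \<le> e n) \<omega>"
    and "((\<lambda>n. e n / \<nu> n) \<longlongrightarrow> l) \<omega>"
  shows "pdist a b \<le> l"
  using nontrivial assms(4) tendsto_pdist[OF assms(1,2)]
proof (rule tendsto_le)
  show "eventually (\<lambda>n. d (a n) (b n) / \<nu> n \<le> e n / \<nu> n) \<omega>"
    using assms(3) by eventually_elim (simp add: divide_right_mono scale_nonneg)
qed

lemma pdist_ge:
  assumes "a \<in> seqs" "b \<in> seqs" "eventually (\<lambda>n. d (a n) (b n) \<ge> e n) \<omega>"
    and "((\<lambda>n. e n / \<nu> n) \<longlongrightarrow> l) \<omega>"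
  shows "pdist a b \<ge> l"
  using nontrivial tendsto_pdist[OF assms(1,2)] assms(4)
proof (rule tendsto_le)
  show "eventually (\<lambda>n. e n / \<nu> n \<le> d (a n) (b n) / \<nu> n) \<omega>"
    using assms(3) by eventually_elim (simp add: divide_right_mono scale_nonneg)
qed

lemma pdist_nonneg: "a \<in> seqs \<Longrightarrow> b \<in> seqs \<Longrightarrow> 0 \<le> pdist a b"
  by (rule pdist_ge[where e = "\<lambda>n. 0"]) auto

lemma pdist_refl: "a \<in> seqs \<Longrightarrow> pdist a a = 0"
  using tendsto_pdist[of a a] seqs_in[of a] by (simp add: tendsto_const_iff)

lemma pdist_commute: "pdist a b = pdist b a"
  by (simp add: cone_pdist_def commute)

lemma pdist_triangle:
  assumes "a \<in> seqs" "b \<in> seqs" "c \<in> seqs"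
  shows "pdist a c \<le> pdist a b + pdist b c"
proof (rule pdist_le)
  show "eventually (\<lambda>n. d (a n) (c n) \<le> d (a n) (b n) + d (b n) (c n)) \<omega>"
    using assms seqs_in triangle by auto
  show "((\<lambda>n. (d (a n) (b n) + d (b n) (c n)) / \<nu> n) \<longlongrightarrow> pdist a b + pdist b c) \<omega>"
    unfolding add_divide_distrib using assms by (intro tendsto_add tendsto_pdist)
qed (use assms in auto)

section \<open>The quotient by distance zero\<close>

lemma equiv_cone_rel: "equiv seqs cone_rel"
proof (rule equivI)
  show "cone_rel \<subseteq> seqs \<times> seqs" by (auto simp: cone_rel_def)
  show "refl_on seqs cone_rel" by (auto simp: refl_on_def cone_rel_def pdist_refl)
  show "sym cone_rel" by (auto simp: sym_def cone_rel_def pdist_commute)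
  show "trans cone_rel"
  proof (rule transI)
    fix a b c assume "(a, b) \<in> cone_rel" "(b, c) \<in> cone_rel"
    then show "(a, c) \<in> cone_rel"
      using pdist_triangle[of a b c] pdist_nonneg[of a c] by (auto simp: cone_rel_def)
  qed
qed

lemma cone_eq: "acone = seqs // cone_rel"
  by (simp add: asymptotic_cone_def cone_rel_def)

lemma cls_in_cone: "a \<in> seqs \<Longrightarrow> cls a \<in> acone"
  by (auto simp: cone_eq cls_def intro: quotientI)

lemma cls_eq_iff: "a \<in> seqs \<Longrightarrow> b \<in> seqs \<Longrightarrow> cls a = cls b \<longleftrightarrow> pdist a b = 0"
  using eq_equiv_class_iff[OF equiv_cone_rel] by (simp add: cls_def cone_rel_def)

lemma
  assumes "A \<in> acone"
  shows rep_in_seqs: "rep A \<in> seqs" and cls_rep: "cls (rep A) = A"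
proof -
  obtain a where a: "a \<in> seqs" "A = cls a"
    using assms by (auto simp: cone_eq cls_def elim: quotientE)
  have "a \<in> A" using a by (auto simp: cls_def cone_rel_def pdist_refl)
  then have "rep A \<in> A" unfolding rep_def by (rule someI[where P = "\<lambda>a. a \<in> A"])
  then have "rep A \<in> seqs \<and> pdist a (rep A) = 0" by (auto simp: a(2) cls_def cone_rel_def)
  then show "rep A \<in> seqs" "cls (rep A) = A" using cls_eq_iff[of "rep A" a] a pdist_commute by auto
qed

lemma cdist_eq: "A \<in> acone \<Longrightarrow> B \<in> acone \<Longrightarrow> cdist A B = pdist (rep A) (rep B)"
  by (simp add: cone_dist_def rep_def)

lemma cdist_cls:
  assumes "a \<in> seqs" "b \<in> seqs"
  shows "cdist (cls a) (cls b) = pdist a b"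
proof -
  define a' b' where "a' = rep (cls a)" and "b' = rep (cls b)"
  have s: "a' \<in> seqs" "b' \<in> seqs" and "cls a' = cls a" "cls b' = cls b"
    using assms by (auto simp: a'_def b'_def cls_in_cone rep_in_seqs cls_rep)
  then have "pdist a a' = 0" "pdist b b' = 0" using assms cls_eq_iff by metis+
  then have "pdist a b = pdist a' b'"
    using pdist_triangle[of a a' b] pdist_triangle[of a' b' b] pdist_triangle[of a' a b']
      pdist_triangle[of a b b'] assms s pdist_commute[of a a'] pdist_commute[of b b'] by auto
  then show ?thesis using assms by (simp add: cdist_eq cls_in_cone a'_def b'_def)
qed

sublocale cone: Metric_space acone cdist
proof
  show "0 \<le> cdist A B" for A B
    using cdist_eq[of A B] pdist_nonneg[of "rep A" "rep B"] rep_in_seqs[of A] rep_in_seqs[of B]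
    by (cases "A \<in> acone \<and> B \<in> acone") (auto simp: cone_dist_def)
  show "cdist A B = cdist B A" for A B
    by (simp add: cone_dist_def pdist_commute)
  show "cdist A B = 0 \<longleftrightarrow> A = B" if "A \<in> acone" "B \<in> acone" for A B
    using that cls_eq_iff[of "rep A" "rep B"] rep_in_seqs cls_rep by (simp add: cdist_eq)
  show "cdist A C \<le> cdist A B + cdist B C" if "A \<in> acone" "B \<in> acone" "C \<in> acone" for A B C
    using that pdist_triangle rep_in_seqs by (simp add: cdist_eq)
qed

end

section \<open>Coarse fillings of geodesic spaces\<close>

lemma tuples_update: "\<lbrakk>a \<in> tuples m M; x \<in> M\<rbrakk> \<Longrightarrow> a[j := x] \<in> tuples m M"
  using set_update_subset_insert[of a j x] by (auto simp: tuples_def)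

lemma tuples_map: "\<lbrakk>a \<in> tuples m A; \<And>x. x \<in> A \<Longrightarrow> f x \<in> B\<rbrakk> \<Longrightarrow> map f a \<in> tuples m B"
  by (auto simp: tuples_def)

lemma tuples_nths:
  assumes "a \<in> tuples m M" "J \<subseteq> {..<m}"
  shows "nths a J \<in> tuples (card J) M"
proof -
  have "{i. i < length a \<and> i \<in> J} = J" using assms by (auto simp: tuples_def)
  then show ?thesis using assms set_nths_subset[of a J] by (auto simp: tuples_def length_nths)
qed

lemma tuples_permute:
  assumes "a \<in> tuples (k + 1) M" "\<sigma> permutes {0..k}"
  shows "permute_list \<sigma> a \<in> tuples (k + 1) M"
proof -
  have "\<sigma> permutes {..<length a}"
    using assms by (simp add: tuples_def atLeast0AtMost lessThan_Suc_atMost)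
  then show ?thesis using assms by (simp add: tuples_def)
qed

locale geodesic_filling = Metric_space +
  fixes r :: nat and F :: "'a list \<Rightarrow> 'a set" and \<Lambda> :: "real \<Rightarrow> real"
  assumes geodesic: "geodesic_space M d"
    and filling: "coarse_filling r M d F \<Lambda>"
begin

lemma near_trans:
  assumes "\<exists>y\<in>A. d x y \<le> e" "\<And>y. y \<in> A \<Longrightarrow> \<exists>z\<in>B. d y z \<le> e'" "x \<in> M" "A \<subseteq> M" "B \<subseteq> M"
  shows "\<exists>z\<in>B. d x z \<le> e + e'"
proof -
  obtain y z where "y \<in> A" "d x y \<le> e" "z \<in> B" "d y z \<le> e'" using assms(1,2) by blast
  moreover have "d x z \<le> d x y + d y z" using assms calculation by (intro triangle) auto
  ultimately show ?thesis by force
qed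

lemma
  shows subset_cond: "\<forall>k\<le>r. \<forall>a\<in>tuples (k + 1) M. F a \<subseteq> M"
    and \<Lambda>_cond: "\<forall>R\<ge>0. 0 \<le> \<Lambda> R" "mono_on {0..} \<Lambda>"
    and F0: "\<forall>x\<in>M. hausdorff_dist d {x} (F [x]) \<le> ennreal (\<Lambda> 0)"
    and F1: "\<forall>k\<in>{1..r}. \<forall>a\<in>tuples (k + 1) M. \<forall>i\<le>k.
      F (nths a ({0..k} - {i})) \<subseteq> nbhd M d (\<Lambda> 0) (F a)"
    and F2: "\<forall>k\<le>r. \<forall>a\<in>tuples (k + 1) M. \<forall>\<sigma>. \<sigma> permutes {0..k} \<longrightarrow>
      hausdorff_dist d (F a) (F (permute_list \<sigma> a)) \<le> ennreal (\<Lambda> 0)"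
    and F3: "\<forall>k<r. \<forall>a\<in>tuples (k + 1) M. F (a @ [last a]) \<subseteq> nbhd M d (\<Lambda> 0) (F a)"
    and F4: "\<forall>k\<le>r. \<forall>a\<in>tuples (k + 1) M. \<forall>R\<ge>0. \<forall>x\<in>nbhd M d R (F a). \<forall>j\<le>k.
      F (a[j := x]) \<subseteq> nbhd M d (\<Lambda> R) (F a)"
  using filling unfolding atomize_conj conj_assoc coarse_filling_def .

section \<open>The filling axioms as estimates between points\<close>

lemma F_subset: "\<lbrakk>k \<le> r; a \<in> tuples (k + 1) M\<rbrakk> \<Longrightarrow> F a \<subseteq> M"
  using subset_cond by blast

lemma \<Lambda>_nonneg: "0 \<le> R \<Longrightarrow> 0 \<le> \<Lambda> R"
  using \<Lambda>_cond(1) by blast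

lemma \<Lambda>_mono: "\<lbrakk>0 \<le> R; R \<le> S\<rbrakk> \<Longrightarrow> \<Lambda> R \<le> \<Lambda> S"
  using \<Lambda>_cond(2) by (auto elim: mono_onD)

text \<open>The summand 1 is needed because the infimum in the distance to a set need not be attained.\<close>

definition "L = \<Lambda> 0 + 1"

lemma L_pos: "0 < L"
  using \<Lambda>_nonneg[of 0] by (simp add: L_def)

lemma
  assumes "x \<in> M"
  shows F_singleton_near: "\<exists>y\<in>F [x]. d x y \<le> L"
    and F_singleton_dist: "y \<in> F [x] \<Longrightarrow> d y x \<le> L"
proof -
  have "hausdorff_dist d {x} (F [x]) \<le> ennreal (\<Lambda> 0)"
    using F0 assms by blast
  from hausdorff_distD[OF this \<Lambda>_nonneg]
  show "\<exists>y\<in>F [x]. d x y \<le> L" "y \<in> F [x] \<Longrightarrow> d y x \<le> L"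
    by (auto simp: L_def)
qed

lemma F_face:
  assumes "1 \<le> k" "k \<le> r" "a \<in> tuples (k + 1) M" "i \<le> k" "x \<in> F (nths a ({0..k} - {i}))"
  shows "\<exists>y\<in>F a. d x y \<le> L"
proof -
  have "x \<in> nbhd M d (\<Lambda> 0) (F a)"
    using assms(5) by (rule rev_subsetD) (use assms(1-4) in \<open>intro F1[rule_format], auto\<close>)
  then obtain y where "y \<in> F a" "d x y \<le> \<Lambda> 0"
    by (rule nbhdD) (use F_subset[OF assms(2,3)] \<Lambda>_nonneg in auto)
  then show ?thesis unfolding L_def by force
qed

lemma
  assumes "k \<le> r" "a \<in> tuples (k + 1) M" "\<sigma> permutes {0..k}"
  shows F_permute1: "x \<in> F a \<Longrightarrow> \<exists>y\<in>F (permute_list \<sigma> a). d x y \<le> L"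
    and F_permute2: "x \<in> F (permute_list \<sigma> a) \<Longrightarrow> \<exists>y\<in>F a. d x y \<le> L"
proof -
  have "hausdorff_dist d (F a) (F (permute_list \<sigma> a)) \<le> ennreal (\<Lambda> 0)"
    using F2 assms by blast
  from hausdorff_distD[OF this \<Lambda>_nonneg]
  show "x \<in> F a \<Longrightarrow> \<exists>y\<in>F (permute_list \<sigma> a). d x y \<le> L"
    "x \<in> F (permute_list \<sigma> a) \<Longrightarrow> \<exists>y\<in>F a. d x y \<le> L"
    by (auto simp: L_def)
qed

lemma F_degenerate:
  assumes "k < r" "a \<in> tuples (k + 1) M" "x \<in> F (a @ [last a])"
  shows "\<exists>y\<in>F a. d x y \<le> L"
proof -
  have "x \<in> nbhd M d (\<Lambda> 0) (F a)"
    using F3 assms by blast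
  then obtain y where "y \<in> F a" "d x y \<le> \<Lambda> 0"
    by (rule nbhdD) (use F_subset[OF less_imp_le[OF assms(1)] assms(2)] \<Lambda>_nonneg in auto)
  then show ?thesis unfolding L_def by force
qed

text \<open>The radius grows from \<open>R\<close> to \<open>R + 1\<close> because (F4) speaks of
  open neighbourhoods, while the hypothesis here is a weak inequality.\<close>

lemma F_update:
  assumes "k \<le> r" "a \<in> tuples (k + 1) M" "j \<le> k" "x \<in> M" "y \<in> F a" "d x y \<le> R" "w \<in> F (a[j := x])"
  shows "\<exists>z\<in>F a. d w z \<le> \<Lambda> (R + 1)"
proof -
  have R: "0 \<le> R + 1" using nonneg[of x y] assms(6) by linarith
  have "x \<in> nbhd M d (R + 1) (F a)" using assms by (intro nbhdI[of _ y]) auto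
  then have "w \<in> nbhd M d (\<Lambda> (R + 1)) (F a)"
    using F4 assms R by blast
  then obtain z where "z \<in> F a" "d w z \<le> \<Lambda> (R + 1)"
    by (rule nbhdD) (use F_subset[OF assms(1,2)] \<Lambda>_nonneg[OF R] in auto)
  then show ?thesis by blast
qed

text \<open>(F0) gives the case of one entry. Otherwise \<open>x\<close> survives in some face, and
  (F1) passes from the face to the whole tuple at cost \<open>L\<close>, once per dimension.\<close>

lemma vertex_near_F:
  assumes "k \<le> r" "a \<in> tuples (k + 1) M" "x \<in> set a"
  shows "\<exists>y\<in>F a. d x y \<le> real (k + 1) * L"
  using assms
proof (induction k arbitrary: a)
  case 0
  then have "a = [x]" by (auto simp: tuples_def length_Suc_conv)
  then show ?case using F_singleton_near[of x] 0 by (auto simp: tuples_def)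
next
  case (Suc k)
  obtain j where j: "j \<le> k + 1" "x = a ! j"
    using Suc.prems by (auto simp: tuples_def in_set_conv_nth less_Suc_eq_le)
  \<comment> \<open>Any index other than \<open>j\<close> may be dropped; with at least two entries,
    \<open>0\<close> or \<open>1\<close> is available.\<close>
  define i where "i = (if j = 0 then 1 else 0::nat)"
  define b where "b = nths a ({0..Suc k} - {i})"
  have "i \<le> Suc k" "j \<noteq> i" by (auto simp: i_def)
  then have "card ({0..Suc k} - {i}) = k + 1" by simp
  then have b: "b \<in> tuples (k + 1) M"
    using tuples_nths[of a "Suc k + 1" M "{0..Suc k} - {i}"] Suc.prems(2)
    by (auto simp: b_def atLeast0AtMost lessThan_Suc_atMost)
  have "x \<in> set b"
    using j \<open>j \<noteq> i\<close> Suc.prems(2) by (auto simp: b_def set_nths tuples_def)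
  then have 1: "\<exists>y\<in>F b. d x y \<le> real (k + 1) * L" using Suc.IH b Suc.prems(1) by simp
  have "\<exists>y\<in>F a. d x y \<le> real (k + 1) * L + L"
  proof (rule near_trans[OF 1])
    show "\<exists>z\<in>F a. d y z \<le> L" if "y \<in> F b" for y
      using F_face[of "Suc k" a i y] Suc.prems \<open>i \<le> Suc k\<close> that by (simp add: b_def)
    show "x \<in> M" using Suc.prems by (auto simp: tuples_def)
    show "F b \<subseteq> M" "F a \<subseteq> M" using F_subset[of k b] b F_subset[of "Suc k" a] Suc.prems by auto
  qed
  then show ?case by (simp add: algebra_simps)
qed

text \<open>Nonemptiness comes from (F0), since the distance to the empty set is infinite, and is
  passed upwards by (F1). It permits choosing sequences in the sets \<open>F\<close>.\<close>

lemma F_nonempty: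
  assumes "k \<le> r" "a \<in> tuples (k + 1) M"
  shows "F a \<noteq> {}"
proof -
  have "hd a \<in> set a" using assms by (intro hd_in_set) (auto simp: tuples_def)
  then show ?thesis using vertex_near_F[OF assms] by blast
qed

text \<open>The cost of moving one vertex by at most 1: an entry of a tuple is within
  \<open>real (r + 1) * L\<close> of its filling, the move adds 1, and the open neighbourhood in
  (F4) adds another 1.\<close>

definition "Q = \<Lambda> (real (r + 1) * L + 2)"

lemma Q_nonneg: "0 \<le> Q"
  using L_pos by (simp add: Q_def \<Lambda>_nonneg)

text \<open>(F4) is applied to \<open>a[j := y]\<close> rather than \<open>a\<close>. There
  \<open>y\<close> is an entry, hence close to the filling, so \<open>x\<close> is close as well,
  and substituting \<open>x\<close> at position \<open>j\<close> produces
  \<open>a[j := x]\<close>.\<close>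

lemma F_update_step:
  assumes "k \<le> r" "a \<in> tuples (k + 1) M" "j \<le> k" "x \<in> M" "y \<in> M" "d x y \<le> 1" "w \<in> F (a[j := x])"
  shows "\<exists>z\<in>F (a[j := y]). d w z \<le> Q"
proof -
  have t: "a[j := y] \<in> tuples (k + 1) M" using assms by (simp add: tuples_update)
  have "y \<in> set (a[j := y])" using assms by (intro set_update_memI) (simp add: tuples_def)
  then obtain v where v: "v \<in> F (a[j := y])" "d y v \<le> real (k + 1) * L"
    using vertex_near_F[OF assms(1) t] by blast
  have "real (k + 1) * L \<le> real (r + 1) * L" using assms(1) L_pos by simp
  moreover have "d x v \<le> d x y + d y v" using assms v F_subset[OF assms(1) t] by (intro triangle) auto
  ultimately have "d x v \<le> real (r + 1) * L + 1" using v assms(6) by simp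
  from F_update[OF assms(1) t assms(3,4) v(1) this, of w] assms(7)
  show ?thesis by (simp add: Q_def add.commute add.left_commute)
qed

text \<open>Geodesics enter here: the vertex travels from \<open>x\<close> to \<open>y\<close> in
  \<open>N\<close> steps of length at most 1, so the cost is linear in the distance however fast
  \<Lambda> grows.\<close>

lemma F_update_chain:
  assumes "k \<le> r" "a \<in> tuples (k + 1) M" "j \<le> k" "x \<in> M" "y \<in> M" "d x y \<le> real N" "w \<in> F (a[j := x])"
  shows "\<exists>z\<in>F (a[j := y]). d w z \<le> real N * Q"
  using assms(4,6,7)
proof (induction N arbitrary: x w)
  case 0
  then have "x = y" using assms(5) nonneg[of x y] by (metis zero order_antisym of_nat_0)
  moreover have "w \<in> M" using F_subset[OF assms(1) tuples_update[OF assms(2) 0(1)]] 0(3) by blast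
  ultimately show ?case using 0 by (auto intro!: bexI[of _ w])
next
  case (Suc N)
  obtain \<gamma> where \<gamma>: "\<gamma> ` {0..d x y} \<subseteq> M" "\<gamma> 0 = x" "\<gamma> (d x y) = y"
    "\<forall>s\<in>{0..d x y}. \<forall>t\<in>{0..d x y}. d (\<gamma> s) (\<gamma> t) = \<bar>s - t\<bar>"
    using geodesic Suc.prems(1) assms(5) unfolding geodesic_space_def by metis
  \<comment> \<open>The minimum covers the last step, which may be shorter than 1.\<close>
  define u where "u = \<gamma> (min 1 (d x y))"
  have mem: "min 1 (d x y) \<in> {0..d x y}" by simp
  have u: "u \<in> M" using \<gamma>(1) mem unfolding u_def by blast
  have "d x u \<le> 1" using \<gamma>(4)[rule_format, of 0, OF _ mem] by (simp add: \<gamma>(2) u_def)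
  then have 1: "\<exists>z\<in>F (a[j := u]). d w z \<le> Q"
    using F_update_step[OF assms(1-3) Suc.prems(1) u] Suc.prems by blast
  have "d u y = d x y - min 1 (d x y)"
    using \<gamma>(4)[rule_format, OF mem, of "d x y"] by (simp add: \<gamma>(3) u_def)
  then have uy: "d u y \<le> real N" using Suc.prems(2) by (simp add: min_def)
  have "\<exists>z\<in>F (a[j := y]). d w z \<le> Q + real N * Q"
  proof (rule near_trans[OF 1])
    show "\<exists>z\<in>F (a[j := y]). d v z \<le> real N * Q" if "v \<in> F (a[j := u])" for v
      using Suc.IH[OF u uy that] .
    show "w \<in> M" using F_subset[OF assms(1) tuples_update[OF assms(2) Suc.prems(1)]] Suc.prems by blast
  qed (use F_subset[OF assms(1) tuples_update[OF assms(2)]] u assms in blast)+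
  then show ?case by (simp add: algebra_simps)
qed

lemma F_update_vertex:
  assumes "k \<le> r" "a \<in> tuples (k + 1) M" "j \<le> k" "x \<in> M" "y \<in> M" "w \<in> F (a[j := x])"
  shows "\<exists>z\<in>F (a[j := y]). d w z \<le> Q * (d x y + 1)"
proof -
  define N where "N = nat \<lceil>d x y\<rceil>"
  have N: "d x y \<le> real N" "real N \<le> d x y + 1"
    using nonneg[of x y] by (auto simp: N_def of_nat_ceiling)
  from F_update_chain[OF assms(1-5) N(1) assms(6)]
  obtain z where "z \<in> F (a[j := y])" "d w z \<le> real N * Q" by blast
  moreover have "real N * Q \<le> Q * (d x y + 1)"
    using mult_left_mono[OF N(2) Q_nonneg] by (simp add: mult.commute)
  ultimately show ?thesis by force
qed

text \<open>The affine substitute for (F4). Since \<open>y\<close> need not be near the old entry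
  \<open>a ! j\<close>, the vertex moves from \<open>x\<close> to \<open>y\<close> along a geodesic,
  and one use of (F4) with \<open>y\<close> itself in \<open>F a\<close> returns to
  \<open>F a\<close>. Thus \<Lambda> is evaluated only at bounded radii.\<close>

lemma F_update_linear:
  assumes "k \<le> r" "a \<in> tuples (k + 1) M" "j \<le> k" "x \<in> M" "y \<in> F a" "w \<in> F (a[j := x])"
  shows "\<exists>z\<in>F a. d w z \<le> Q * (d x y + 2)"
proof -
  have y: "y \<in> M" using F_subset assms by blast
  have "\<exists>z\<in>F a. d w z \<le> Q * (d x y + 1) + Q"
  proof (rule near_trans[OF F_update_vertex[OF assms(1-4) y assms(6)]])
    show "\<exists>z\<in>F a. d v z \<le> Q" if v: "v \<in> F (a[j := y])" for v
    proof -
      have "d y y \<le> 0" using y by simp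
      from F_update[OF assms(1-3) y assms(5) this v]
      obtain z where "z \<in> F a" "d v z \<le> \<Lambda> 1" by auto
      moreover have "\<Lambda> 1 \<le> Q" using L_pos by (auto simp: Q_def intro!: \<Lambda>_mono add_increasing)
      ultimately show ?thesis by force
    qed
    show "w \<in> M" using F_subset[OF assms(1) tuples_update[OF assms(2,4)]] assms by blast
  qed (use F_subset[OF assms(1)] tuples_update[OF assms(2) y] assms(2) in blast)+
  then show ?thesis by (simp add: algebra_simps)
qed

section \<open>Bounds on the size of the sets F\<close>

lemma F_replicate:
  assumes "k \<le> r" "q \<in> M" "y \<in> F (replicate (k + 1) q)"
  shows "d y q \<le> real (k + 1) * L"
  using assms(1,3)
proof (induction k arbitrary: y)
  case 0
  then show ?case using F_singleton_dist[OF assms(2), of y] by simp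
next
  case (Suc k)
  \<comment> \<open>This grouping exhibits the repeated last entry that (F3) removes.\<close>
  have rep: "replicate (Suc k + 1) q = replicate (k + 1) q @ [last (replicate (k + 1) q)]"
    by (simp add: replicate_append_same)
  have t: "replicate m q \<in> tuples m M" for m using assms(2) by (auto simp: tuples_def)
  obtain z where z: "z \<in> F (replicate (k + 1) q)" "d y z \<le> L"
    using F_degenerate[of k "replicate (k + 1) q" y] Suc.prems t[of "k + 1"] rep by auto
  have "y \<in> M" using F_subset[OF Suc.prems(1) t] Suc.prems(2) by blast
  moreover have "z \<in> M" using F_subset[OF _ t, of k] Suc.prems(1) z by auto
  ultimately have "d y q \<le> d y z + d z q" using assms(2) by (intro triangle)
  moreover have "d z q \<le> real (k + 1) * L" using Suc.IH z Suc.prems by simp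
  ultimately show ?case using z by (simp add: algebra_simps)
qed

text \<open>The entries are moved to \<open>q\<close> one at a time from the left, each over a
  distance at most \<open>T\<close>; \<open>m\<close> counts the entries already moved.\<close>

lemma F_collapse:
  assumes "k \<le> r" "a \<in> tuples (k + 1) M" "q \<in> M" "\<And>x. x \<in> set a \<Longrightarrow> d x q \<le> T"
    and "m \<le> k + 1" "y \<in> F a"
  shows "\<exists>z\<in>F (replicate m q @ drop m a). d y z \<le> real m * (Q * (T + 1))"
  using assms(5)
proof (induction m)
  case 0
  have "y \<in> M" using F_subset assms by blast
  then show ?case using assms(6) by (auto intro!: bexI[of _ y])
next
  case (Suc m)
  define c where "c = replicate m q @ drop m a"
  have len: "length a = k + 1" using assms(2) by (simp add: tuples_def)
  have c: "c \<in> tuples (k + 1) M"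
    using assms(2,3) Suc.prems set_drop_subset[of m a] by (auto simp: c_def tuples_def)
  have nth: "c ! m = a ! m" using Suc.prems len by (simp add: c_def nth_append)
  have upd: "c[m := q] = replicate (Suc m) q @ drop (Suc m) a"
  proof -
    have "drop m a = a ! m # drop (Suc m) a" using Suc.prems len by (simp add: Cons_nth_drop_Suc)
    then show ?thesis by (simp add: c_def list_update_append replicate_append_same[symmetric])
  qed
  have am: "a ! m \<in> set a" using Suc.prems len by simp
  have "\<exists>z\<in>F (c[m := q]). d y z \<le> real m * (Q * (T + 1)) + Q * (T + 1)"
  proof (rule near_trans)
    show "\<exists>z\<in>F c. d y z \<le> real m * (Q * (T + 1))" using Suc by (simp add: c_def)
    show "\<exists>z\<in>F (c[m := q]). d v z \<le> Q * (T + 1)" if "v \<in> F c" for v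
    proof -
      have "v \<in> F (c[m := a ! m])" using that nth by (metis list_update_id)
      then obtain z where "z \<in> F (c[m := q])" "d v z \<le> Q * (d (a ! m) q + 1)"
        using F_update_vertex[OF assms(1) c, of m "a ! m" q v] Suc.prems am assms(2,3)
        by (auto simp: tuples_def subset_iff)
      moreover have "Q * (d (a ! m) q + 1) \<le> Q * (T + 1)"
        using assms(4)[OF am] Q_nonneg by (intro mult_left_mono) auto
      ultimately show ?thesis by force
    qed
    show "y \<in> M" using F_subset assms by blast
  qed (use F_subset[OF assms(1)] c tuples_update[OF c assms(3)] in blast)+
  then show ?case by (simp add: upd algebra_simps)
qed

text \<open>Collapse to the constant tuple at \<open>q\<close>, whose filling is near
  \<open>q\<close>. The bound is affine in \<open>T\<close>, so entries of size O(\<nu>) force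
  points of \<open>F\<close> of size O(\<nu>).\<close>

lemma F_bounded:
  assumes "k \<le> r" "a \<in> tuples (k + 1) M" "q \<in> M" "\<And>x. x \<in> set a \<Longrightarrow> d x q \<le> T" "y \<in> F a"
  shows "d y q \<le> real (k + 1) * (Q * (T + 1) + L)"
proof -
  have "length a = k + 1" using assms(2) by (simp add: tuples_def)
  then obtain z where z: "z \<in> F (replicate (k + 1) q)" "d y z \<le> real (k + 1) * (Q * (T + 1))"
    using F_collapse[OF assms(1-4) order_refl assms(5)] by auto
  have "replicate (k + 1) q \<in> tuples (k + 1) M" using assms(3) by (auto simp: tuples_def)
  then have "y \<in> M" "z \<in> M" using F_subset[OF assms(1)] assms z by blast+
  then have "d y q \<le> d y z + d z q" using assms(3) by (intro triangle)
  then show ?thesis using z F_replicate[OF assms(1,3) z(1)] by (simp add: algebra_simps)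
qed

end


section \<open>The ultralimit of a coarse filling\<close>

locale cone_filling = asymptotic_cone_space + geodesic_filling
begin

abbreviation slice :: "nat \<Rightarrow> (nat \<Rightarrow> 'a) list \<Rightarrow> 'a list" where
  "slice n bs \<equiv> map (\<lambda>b. b n) bs"

text \<open>Membership is demanded at every \<open>n\<close>, which loses nothing because the sets
  are nonempty and a sequence may be altered off an \<omega>-large set. That \<open>y\<close> lies
  in \<open>seqs\<close> is automatic.\<close>

definition ultralimit :: "(nat \<Rightarrow> 'a) list \<Rightarrow> (nat \<Rightarrow> 'a) set set" where
  "ultralimit bs = {cls y |y. \<forall>n. y n \<in> F (slice n bs)}"

text \<open>Fixing representatives by \<open>rep\<close> makes this a function of the classes
  without a separate argument for well-definedness.\<close>

definition cone_F :: "(nat \<Rightarrow> 'a) set list \<Rightarrow> (nat \<Rightarrow> 'a) set set" where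
  "cone_F As = ultralimit (map rep As)"

lemma slice_tuples: "bs \<in> tuples m seqs \<Longrightarrow> slice n bs \<in> tuples m M"
  by (erule tuples_map) (rule seqs_in)

lemma map_rep_tuples: "As \<in> tuples m acone \<Longrightarrow> map rep As \<in> tuples m seqs"
  by (erule tuples_map) (rule rep_in_seqs)

lemma tendsto_affine_over_scale:
  assumes "((\<lambda>n. e n / \<nu> n) \<longlongrightarrow> l) \<omega>"
  shows "((\<lambda>n. (c * e n + b) / \<nu> n) \<longlongrightarrow> c * l) \<omega>"
proof -
  have "((\<lambda>n. c * (e n / \<nu> n) + b / \<nu> n) \<longlongrightarrow> c * l + 0) \<omega>"
    using assms tendsto_const_over_scale by (intro tendsto_intros)
  then show ?thesis by (simp add: add_divide_distrib)
qed

lemma base_in_seqs: "(\<lambda>n. p) \<in> seqs"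
  using base by (auto simp: seqs_iff intro!: exI[of _ 0])

text \<open>\<open>F_bounded\<close> is applied at each \<open>n\<close> around the base point with
  radius \<open>T * \<nu> n\<close>; the resulting affine bound stays finite after
  rescaling.\<close>

lemma ultralimit_seqs:
  assumes "k \<le> r" "bs \<in> tuples (k + 1) seqs" "\<And>n. y n \<in> F (slice n bs)"
  shows "y \<in> seqs"
proof -
  have "\<exists>K. eventually (\<lambda>n. d (b n) p \<le> K * \<nu> n) \<omega>" if "b \<in> set bs" for b
    using that assms(2) by (auto simp: tuples_def seqs_iff)
  then obtain K where K: "\<And>b. b \<in> set bs \<Longrightarrow> eventually (\<lambda>n. d (b n) p \<le> K b * \<nu> n) \<omega>"
    by metis
  define T where "T = (\<Sum>b\<in>set bs. \<bar>K b\<bar>)"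
  have KT: "K b \<le> T" if "b \<in> set bs" for b
    using member_le_sum[of b "set bs" "\<lambda>b. \<bar>K b\<bar>"] that by (simp add: T_def)
  have "eventually (\<lambda>n. \<forall>b\<in>set bs. d (b n) p \<le> K b * \<nu> n) \<omega>"
    using K by (intro eventually_ball_finite) auto
  then have "eventually (\<lambda>n. d (y n) p \<le> real (k + 1) * (Q * (T * \<nu> n + 1) + L)) \<omega>"
  proof eventually_elim
    case (elim n)
    show ?case
    proof (rule F_bounded[OF assms(1) slice_tuples[OF assms(2)] base _ assms(3)])
      fix x assume "x \<in> set (slice n bs)"
      then obtain b where b: "b \<in> set bs" "x = b n" by auto
      have "K b * \<nu> n \<le> T * \<nu> n" using KT[OF b(1)] scale_nonneg by (rule mult_right_mono)
      then show "d x p \<le> T * \<nu> n" using elim b by force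
    qed
  qed
  then have ev: "eventually (\<lambda>n. d (y n) p \<le> (real (k + 1) * Q) * (T * \<nu> n) + real (k + 1) * (Q + L)) \<omega>"
    by (simp add: algebra_simps)
  have "T * \<nu> n / \<nu> n = T" for n using scale_pos[of n] by simp
  then have "((\<lambda>n. ((real (k + 1) * Q) * (T * \<nu> n) + real (k + 1) * (Q + L)) / \<nu> n)
      \<longlongrightarrow> (real (k + 1) * Q) * T) \<omega>"
    by (intro tendsto_affine_over_scale) simp
  moreover have "range y \<subseteq> M"
    using F_subset[OF assms(1) slice_tuples[OF assms(2)]] assms(3) by blast
  ultimately show ?thesis using seqs_near[OF base_in_seqs _ ev] by blast
qed

lemma ultralimit_subset: "\<lbrakk>k \<le> r; bs \<in> tuples (k + 1) seqs\<rbrakk> \<Longrightarrow> ultralimit bs \<subseteq> acone"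
  by (auto simp: ultralimit_def intro!: cls_in_cone ultralimit_seqs)

lemma cone_F_subset: "\<lbrakk>k \<le> r; As \<in> tuples (k + 1) acone\<rbrakk> \<Longrightarrow> cone_F As \<subseteq> acone"
  unfolding cone_F_def by (intro ultralimit_subset map_rep_tuples)

lemma
  assumes "k \<le> r" "bs \<in> tuples (k + 1) seqs" "range x \<subseteq> M"
    and "eventually (\<lambda>n. \<exists>y\<in>F (slice n bs). d (x n) y \<le> e n) \<omega>"
    and "((\<lambda>n. e n / \<nu> n) \<longlongrightarrow> l) \<omega>"
  shows near_ultralimit_seqs: "x \<in> seqs"
    and near_ultralimit: "\<exists>Y\<in>ultralimit bs. cdist (cls x) Y \<le> l"
proof -
  \<comment> \<open>The implication makes the choice total: where no point within \<open>e n\<close>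
    exists, any point of the nonempty set serves.\<close>
  have "\<exists>y\<in>F (slice n bs). (\<exists>y\<in>F (slice n bs). d (x n) y \<le> e n) \<longrightarrow> d (x n) y \<le> e n" for n
    using F_nonempty[OF assms(1) slice_tuples[OF assms(2)], of n] by blast
  then obtain y where y: "\<And>n. y n \<in> F (slice n bs)"
    "\<And>n. \<exists>y\<in>F (slice n bs). d (x n) y \<le> e n \<Longrightarrow> d (x n) (y n) \<le> e n"
    by metis
  have ys: "y \<in> seqs" using assms(1,2) y(1) by (rule ultralimit_seqs)
  have ev: "eventually (\<lambda>n. d (x n) (y n) \<le> e n) \<omega>"
    using assms(4) by eventually_elim (rule y(2))
  show xs: "x \<in> seqs" using ys assms(3) ev assms(5) by (rule seqs_near)
  have "cdist (cls x) (cls y) \<le> l"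
    using pdist_le[OF xs ys ev assms(5)] by (simp add: cdist_cls xs ys)
  then show "\<exists>Y\<in>ultralimit bs. cdist (cls x) Y \<le> l" using y(1) by (auto simp: ultralimit_def)
qed

text \<open>A constant error rescales to distance 0, and sequences at distance 0 are the same point
  of the cone. Estimates up to a constant thereby become exact membership.\<close>

lemma sublinear_near_ultralimit:
  assumes "k \<le> r" "bs \<in> tuples (k + 1) seqs" "range x \<subseteq> M"
    and "\<And>n. \<exists>y\<in>F (slice n bs). d (x n) y \<le> c"
  shows "cls x \<in> ultralimit bs"
proof -
  have ev: "eventually (\<lambda>n. \<exists>y\<in>F (slice n bs). d (x n) y \<le> c) \<omega>" using assms(4) by simp
  note near = assms(1-3) ev tendsto_const_over_scale
  obtain Y where Y: "Y \<in> ultralimit bs" "cdist (cls x) Y \<le> 0"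
    using near_ultralimit[OF near] by blast
  moreover have "cls x \<in> acone" using near_ultralimit_seqs[OF near] by (rule cls_in_cone)
  moreover have "Y \<in> acone" using Y ultralimit_subset[OF assms(1,2)] by blast
  ultimately show ?thesis using cone.nonneg[of "cls x" Y] by (metis cone.zero order_antisym)
qed

lemma ultralimit_mono:
  assumes "k \<le> r" "bs \<in> tuples (k + 1) seqs" "m \<le> r" "cs \<in> tuples (m + 1) seqs"
    and "\<And>n x. x \<in> F (slice n bs) \<Longrightarrow> \<exists>y\<in>F (slice n cs). d x y \<le> c"
  shows "ultralimit bs \<subseteq> ultralimit cs"
proof
  fix X assume "X \<in> ultralimit bs"
  then obtain x where x: "X = cls x" "\<And>n. x n \<in> F (slice n bs)" by (auto simp: ultralimit_def)
  have "range x \<subseteq> M" using x(2) F_subset[OF assms(1) slice_tuples[OF assms(2)]] by blast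
  then show "X \<in> ultralimit cs"
    unfolding x(1) using assms(5) x(2) by (intro sublinear_near_ultralimit[OF assms(3,4), where c = c]) auto
qed

section \<open>The filling axioms in the cone\<close>

lemma cone_F_singleton:
  assumes "X \<in> acone"
  shows "cone_F [X] = {X}"
proof -
  have s: "rep X \<in> seqs" using assms by (rule rep_in_seqs)
  then have t: "[rep X] \<in> tuples (0 + 1) seqs" by (simp add: tuples_def)
  have "X \<in> ultralimit [rep X]"
  proof -
    have "cls (rep X) \<in> ultralimit [rep X]"
      using seqs_in[OF s] by (intro sublinear_near_ultralimit[OF _ t, where c = L]) (auto intro: F_singleton_near)
    then show ?thesis using cls_rep[OF assms] by simp
  qed
  moreover have "Y = X" if Y: "Y \<in> ultralimit [rep X]" for Y
  proof -
    obtain y where y: "Y = cls y" "\<And>n. y n \<in> F [rep X n]" using Y by (auto simp: ultralimit_def)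
    have ys: "y \<in> seqs" using ultralimit_seqs[OF _ t, of y] y by simp
    have "pdist y (rep X) \<le> 0"
      using F_singleton_dist[OF seqs_in[OF s] y(2)]
      by (intro pdist_le[OF ys s _ tendsto_const_over_scale, of L]) simp
    then have "cls y = cls (rep X)" using pdist_nonneg[OF ys s] cls_eq_iff[OF ys s] by simp
    then show ?thesis using y(1) cls_rep[OF assms] by simp
  qed
  ultimately show ?thesis by (auto simp: cone_F_def)
qed

text \<open>Rescaling \<open>F_update_linear\<close> removes the constant \<open>2 * Q\<close> and
  leaves slope \<open>Q\<close>, with a weak inequality. Slope \<open>Q + 1\<close> makes it strict
  when \<open>R > 0\<close>; for \<open>R = 0\<close> the two points coincide.\<close>

lemma cone_F_update:
  assumes "k \<le> r" "As \<in> tuples (k + 1) acone" "0 \<le> R" "X \<in> nbhd acone cdist R (cone_F As)" "j \<le> k"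
  shows "cone_F (As[j := X]) \<subseteq> nbhd acone cdist ((Q + 1) * R) (cone_F As)"
proof
  fix W assume W: "W \<in> cone_F (As[j := X])"
  note sub = cone_F_subset[OF assms(1,2)]
  have X: "X \<in> acone" using assms(4) cone.nbhd_subset[OF sub] by blast
  define bs where "bs = map rep As"
  have bs: "bs \<in> tuples (k + 1) seqs" using assms(2) by (simp add: bs_def map_rep_tuples)
  note xs = rep_in_seqs[OF X]
  obtain Y where "Y \<in> cone_F As" "cdist X Y \<le> R"
    using assms(4) sub assms(3) by (rule cone.nbhdD)
  then obtain y where y: "cdist X (cls y) \<le> R" "\<And>n. y n \<in> F (slice n bs)"
    by (auto simp: cone_F_def ultralimit_def bs_def)
  have ys: "y \<in> seqs" using assms(1) bs y(2) by (rule ultralimit_seqs)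
  have xy: "pdist (rep X) y \<le> R" using y(1) cdist_cls[OF xs ys] cls_rep[OF X] by simp
  obtain w where w: "W = cls w" "\<And>n. w n \<in> F (slice n (bs[j := rep X]))"
    using W by (auto simp: cone_F_def ultralimit_def bs_def map_update)
  have ws: "w \<in> seqs" using assms(1) tuples_update[OF bs xs] w(2) by (rule ultralimit_seqs)
  have Wc: "W \<in> acone" using w(1) ws by (simp add: cls_in_cone)
  have "\<exists>z\<in>F (slice n bs). d (w n) z \<le> Q * d (rep X n) (y n) + 2 * Q" for n
  proof -
    have "w n \<in> F ((slice n bs)[j := rep X n])" using w(2)[of n] by (simp add: map_update)
    from F_update_linear[OF assms(1) slice_tuples[OF bs] assms(5) seqs_in[OF xs] y(2) this]
    show ?thesis by (simp add: algebra_simps)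
  qed
  then have ev: "eventually (\<lambda>n. \<exists>z\<in>F (slice n bs). d (w n) z \<le> Q * d (rep X n) (y n) + 2 * Q) \<omega>" by simp
  have "range w \<subseteq> M" using seqs_in[OF ws] by blast
  from near_ultralimit[OF assms(1) bs this ev tendsto_affine_over_scale[OF tendsto_pdist[OF xs ys]]]
  obtain Z where Z: "Z \<in> cone_F As" "cdist W Z \<le> Q * pdist (rep X) y"
    by (auto simp: cone_F_def bs_def w(1))
  have le: "cdist W Z \<le> Q * R" using Z(2) mult_left_mono[OF xy Q_nonneg] by simp
  have "cdist W Z < (Q + 1) * R \<or> (Q + 1) * R = 0 \<and> W = Z"
  proof (cases "R = 0")
    case True
    then show ?thesis using le cone.nonneg[of W Z] Wc Z(1) sub by auto
  next
    case False
    then show ?thesis using le assms(3) by (simp add: distrib_right)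
  qed
  then show "W \<in> nbhd acone cdist ((Q + 1) * R) (cone_F As)"
    using Wc Z(1) assms(3) Q_nonneg by (auto simp: cone.mem_nbhd_iff[OF sub])
qed

text \<open>The control vanishes at 0, so (F0) to (F3) must hold exactly. They do, because their
  errors in the space are at most \<open>L\<close> and \<open>ultralimit_mono\<close> absorbs
  constants.\<close>

lemma filling_cone_F: "filling r acone cdist cone_F (\<lambda>R. (Q + 1) * R)"
proof -
  have eq: "hausdorff_dist cdist A A \<le> ennreal 0" if "A \<subseteq> acone" for A
    using cone.hausdorff_dist_same[OF that] by simp
  have face: "cone_F (nths As ({0..k} - {i})) \<subseteq> cone_F As"
    if k: "k \<in> {1..r}" and As: "As \<in> tuples (k + 1) acone" and i: "i \<le> k" for k As i
  proof -
    define bs where "bs = map rep As"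
    have bs: "bs \<in> tuples (k + 1) seqs" using As by (simp add: bs_def map_rep_tuples)
    have "card ({0..k} - {i}) = (k - 1) + 1" using k i by simp
    then have t: "nths bs ({0..k} - {i}) \<in> tuples ((k - 1) + 1) seqs"
      using tuples_nths[OF bs, of "{0..k} - {i}"] by (auto simp: atLeast0AtMost lessThan_Suc_atMost)
    have "ultralimit (nths bs ({0..k} - {i})) \<subseteq> ultralimit bs"
    proof (rule ultralimit_mono[OF _ t _ bs])
      show "\<exists>y\<in>F (slice n bs). d x y \<le> L" if "x \<in> F (slice n (nths bs ({0..k} - {i})))" for n x
        using that k i by (intro F_face[OF _ _ slice_tuples[OF bs]]) (auto simp: nths_map)
    qed (use k in auto)
    then show ?thesis by (simp add: cone_F_def bs_def nths_map)
  qed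
  have perm: "cone_F (permute_list \<sigma> As) = cone_F As"
    if k: "k \<le> r" and As: "As \<in> tuples (k + 1) acone" and \<sigma>: "\<sigma> permutes {0..k}" for k As \<sigma>
  proof -
    define bs where "bs = map rep As"
    have bs: "bs \<in> tuples (k + 1) seqs" using As by (simp add: bs_def map_rep_tuples)
    have p: "\<sigma> permutes {..<length bs}" "\<sigma> permutes {..<length As}"
      using \<sigma> bs As by (simp_all add: tuples_def atLeast0AtMost lessThan_Suc_atMost)
    have sl: "slice n (permute_list \<sigma> bs) = permute_list \<sigma> (slice n bs)" for n
      using p by (simp add: permute_list_map)
    note tb = tuples_permute[OF bs \<sigma>]
    have "ultralimit (permute_list \<sigma> bs) = ultralimit bs"
    proof
      show "ultralimit (permute_list \<sigma> bs) \<subseteq> ultralimit bs"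
        unfolding sl by (rule ultralimit_mono[OF k tb k bs, of L], unfold sl,
            rule F_permute2[OF k slice_tuples[OF bs] \<sigma>])
      show "ultralimit bs \<subseteq> ultralimit (permute_list \<sigma> bs)"
        by (rule ultralimit_mono[OF k bs k tb, of L], unfold sl,
            rule F_permute1[OF k slice_tuples[OF bs] \<sigma>])
    qed
    then show ?thesis using p by (simp add: cone_F_def bs_def permute_list_map)
  qed
  have degenerate: "cone_F (As @ [last As]) \<subseteq> cone_F As"
    if k: "k < r" and As: "As \<in> tuples (k + 1) acone" for k As
  proof -
    define bs where "bs = map rep As"
    have bs: "bs \<in> tuples (k + 1) seqs" using As by (simp add: bs_def map_rep_tuples)
    have ne: "bs \<noteq> []" "As \<noteq> []" using bs As by (auto simp: tuples_def)
    then have "last bs \<in> set bs" by simp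
    then have t: "bs @ [last bs] \<in> tuples (Suc k + 1) seqs" using bs by (auto simp: tuples_def)
    have "ultralimit (bs @ [last bs]) \<subseteq> ultralimit bs"
    proof (rule ultralimit_mono[OF _ t _ bs])
      show "\<exists>y\<in>F (slice n bs). d x y \<le> L" if "x \<in> F (slice n (bs @ [last bs]))" for n x
        using that ne by (intro F_degenerate[OF k slice_tuples[OF bs]]) (simp add: last_map)
    qed (use k in auto)
    then show ?thesis using ne by (simp add: cone_F_def bs_def last_map)
  qed
  have "coarse_filling r acone cdist cone_F (\<lambda>R. (Q + 1) * R)"
    unfolding coarse_filling_def
  proof (intro conjI)
    show "mono_on {0..} (\<lambda>R. (Q + 1) * R)"
      using Q_nonneg by (auto intro!: mono_onI mult_left_mono)
    show "\<forall>x\<in>acone. hausdorff_dist cdist {x} (cone_F [x]) \<le> ennreal ((Q + 1) * 0)"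
      using eq by (simp add: cone_F_singleton)
    show "\<forall>k\<in>{1..r}. \<forall>a\<in>tuples (k + 1) acone. \<forall>i\<le>k.
        cone_F (nths a ({0..k} - {i})) \<subseteq> nbhd acone cdist ((Q + 1) * 0) (cone_F a)"
      using face by (simp add: nbhd_def)
    show "\<forall>k\<le>r. \<forall>a\<in>tuples (k + 1) acone. \<forall>\<sigma>. \<sigma> permutes {0..k} \<longrightarrow>
        hausdorff_dist cdist (cone_F a) (cone_F (permute_list \<sigma> a)) \<le> ennreal ((Q + 1) * 0)"
      using perm eq cone_F_subset by simp
    show "\<forall>k<r. \<forall>a\<in>tuples (k + 1) acone.
        cone_F (a @ [last a]) \<subseteq> nbhd acone cdist ((Q + 1) * 0) (cone_F a)"
      using degenerate by (simp add: nbhd_def)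
    show "\<forall>k\<le>r. \<forall>a\<in>tuples (k + 1) acone. \<forall>R\<ge>0. \<forall>x\<in>nbhd acone cdist R (cone_F a). \<forall>j\<le>k.
        cone_F (a[j := x]) \<subseteq> nbhd acone cdist ((Q + 1) * R) (cone_F a)"
      using cone_F_update by blast
  qed (use cone_F_subset Q_nonneg in auto)
  then show ?thesis by (simp add: filling_def)
qed


section \<open>The median conditions in the cone\<close>

lemma face_tuples:
  assumes "bs \<in> tuples (r + 2) A" "J \<noteq> {}" "J \<subset> {0..r + 1}"
  obtains k where "k \<le> r" "nths bs J \<in> tuples (k + 1) A"
proof -
  have fin: "finite J" using assms(3) by (meson finite_atLeastAtMost finite_subset psubset_imp_subset)
  have "J \<subseteq> {..<r + 2}" using assms(3) by auto
  then have t: "nths bs J \<in> tuples (card J) A" by (rule tuples_nths[OF assms(1)])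
  have "card J \<noteq> 0" using fin assms(2) by simp
  moreover have "card J < r + 2" using psubset_card_mono[OF _ assms(3)] by simp
  ultimately show ?thesis using t by (intro that[of "card J - 1"]) auto
qed

lemma cone_F_nths:
  "cone_F (nths As J) = ultralimit (nths (map rep As) J)"
  by (simp add: cone_F_def nths_map)

text \<open>Otherwise one family of faces violates genericity for \<omega>-almost all
  \<open>n\<close>, and the pairs of points witnessing large diameters converge to such a pair in
  the cone. In the limit the points are within \<open>l\<close> of the faces and at least
  \<open>m\<close> apart; strictness of the gaps to \<delta> and \<open>D\<close> contradicts
  \<open>gen\<close>.\<close>

lemma eventually_generic:
  assumes gen: "generic r acone cdist cone_F \<delta> D As"
    and g: "((\<lambda>n. s n / \<nu> n) \<longlongrightarrow> l) \<omega>" "l < \<delta> \<or> l = 0 \<and> \<delta> = 0" "\<And>n. 0 \<le> s n"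
    and t: "((\<lambda>n. t n / \<nu> n) \<longlongrightarrow> m) \<omega>" "D < m" "\<And>n. 0 \<le> t n"
    and "0 \<le> \<delta>" "0 \<le> D"
  shows "eventually (\<lambda>n. generic r M d F (s n) (t n) (slice n (map rep As))) \<omega>"
proof (rule ccontr)
  assume neg: "\<not> ?thesis"
  define bs where "bs = map rep As"
  have As: "As \<in> tuples (r + 2) acone" using gen by (simp add: generic_iff_family)
  then have bs: "bs \<in> tuples (r + 2) seqs" by (simp add: bs_def map_rep_tuples)
  define bad where "bad \<I> n \<longleftrightarrow> ediam d (\<Inter>J\<in>\<I>. nbhd M d (s n) (F (nths (slice n bs) J))) > ennreal (t n)"
    for \<I> n
  \<comment> \<open>Only families that would violate the conclusion of genericity are
    collected.\<close>
  define \<S> where "\<S> = {\<I>. \<I> \<noteq> {} \<and> \<I> \<subseteq> Pow {0..r + 1} - {{}, {0..r + 1}} \<and> \<Inter>\<I> = {} \<and> (\<exists>J\<in>\<I>. card J \<noteq> r + 1)}"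
  have "finite \<S>" by (rule finite_subset[of _ "Pow (Pow {0..r + 1})"]) (auto simp: \<S>_def)
  moreover have "eventually (\<lambda>n. \<not> generic r M d F (s n) (t n) (slice n bs)) \<omega>"
    using neg ultra unfolding nonprincipal_ultrafilter_def bs_def by blast
  then have "eventually (\<lambda>n. \<exists>\<I>\<in>\<S>. bad \<I> n) \<omega>"
    by eventually_elim (use slice_tuples[OF bs] in \<open>auto simp: generic_iff_family \<S>_def bad_def\<close>)
  ultimately obtain \<I> where \<I>: "\<I> \<in> \<S>" "eventually (bad \<I>) \<omega>"
    using ultrafilter_finite_range[OF ultra] by blast
  have proper: "J \<noteq> {}" "J \<subset> {0..r + 1}" if "J \<in> \<I>" for J using \<I>(1) that by (auto simp: \<S>_def)
  obtain J0 where J0: "J0 \<in> \<I>" using \<I>(1) by (auto simp: \<S>_def)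
  have Fsub: "F (nths (slice n bs) J) \<subseteq> M" if "J \<in> \<I>" for n J
    using face_tuples[OF slice_tuples[OF bs] proper[OF that]] F_subset by metis
  \<comment> \<open>At indices where \<open>bad\<close> fails the base point fills in, so that the
    chosen sequences are defined everywhere.\<close>
  have "\<exists>x y. x \<in> M \<and> y \<in> M \<and> (bad \<I> n \<longrightarrow> t n < d x y \<and>
      (\<forall>J\<in>\<I>. x \<in> nbhd M d (s n) (F (nths (slice n bs) J)) \<and> y \<in> nbhd M d (s n) (F (nths (slice n bs) J))))" for n
  proof (cases "bad \<I> n")
    case True
    then obtain x y where "t n < d x y"
      "\<forall>J\<in>\<I>. x \<in> nbhd M d (s n) (F (nths (slice n bs) J)) \<and> y \<in> nbhd M d (s n) (F (nths (slice n bs) J))"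
      unfolding bad_def less_ediam_iff[OF t(3)] by blast
    moreover from this have "x \<in> M" "y \<in> M" using nbhd_subset[OF Fsub[OF J0]] J0 by blast+
    ultimately show ?thesis by blast
  qed (use base in blast)
  then obtain x y where xM: "\<And>n. x n \<in> M" "\<And>n. y n \<in> M" and
    xy: "\<And>n. bad \<I> n \<Longrightarrow> t n < d (x n) (y n)" and
    x: "\<And>n J. \<lbrakk>bad \<I> n; J \<in> \<I>\<rbrakk> \<Longrightarrow> x n \<in> nbhd M d (s n) (F (nths (slice n bs) J))" and
    y: "\<And>n J. \<lbrakk>bad \<I> n; J \<in> \<I>\<rbrakk> \<Longrightarrow> y n \<in> nbhd M d (s n) (F (nths (slice n bs) J))"
    by metis
  have lim: "z \<in> seqs \<and> cls z \<in> nbhd acone cdist \<delta> (cone_F (nths As J))"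
    if z: "\<And>n. z n \<in> M" "\<And>n. bad \<I> n \<Longrightarrow> z n \<in> nbhd M d (s n) (F (nths (slice n bs) J))"
      and J: "J \<in> \<I>" for z J
  proof -
    obtain k where k: "k \<le> r" "nths bs J \<in> tuples (k + 1) seqs"
      using face_tuples[OF bs proper[OF J]] by blast
    have "eventually (\<lambda>n. \<exists>v\<in>F (slice n (nths bs J)). d (z n) v \<le> s n) \<omega>" using \<I>(2)
    proof eventually_elim
      case (elim n)
      obtain v where "v \<in> F (nths (slice n bs) J)" "d (z n) v \<le> s n"
        using z(2)[OF elim] Fsub[OF J] g(3) by (rule nbhdD)
      then show ?case by (auto simp: nths_map)
    qed
    moreover have "range z \<subseteq> M" using z(1) by blast
    ultimately have near: "z \<in> seqs" "\<exists>Y\<in>ultralimit (nths bs J). cdist (cls z) Y \<le> l"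
      using near_ultralimit_seqs[OF k _ _ g(1)] near_ultralimit[OF k _ _ g(1)] by blast+
    then obtain Y where Y: "Y \<in> ultralimit (nths bs J)" "cdist (cls z) Y \<le> l" by blast
    note sub = ultralimit_subset[OF k]
    have "cdist (cls z) Y < \<delta> \<or> \<delta> = 0 \<and> cls z = Y"
      using g(2) Y sub cone.nonneg[of "cls z" Y] cls_in_cone[OF near(1)] by auto
    then show ?thesis using near(1) Y(1) cone.mem_nbhd_iff[OF sub assms(8)] cls_in_cone
      by (auto simp: cone_F_nths bs_def)
  qed
  note xs = lim[OF xM(1) x] and ys = lim[OF xM(2) y]
  have "eventually (\<lambda>n. t n \<le> d (x n) (y n)) \<omega>"
    using \<I>(2) by eventually_elim (use xy in \<open>auto intro: less_imp_le\<close>)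
  then have "m \<le> pdist (x) y" using xs ys J0 t(1) by (intro pdist_ge) auto
  then have "D < cdist (cls x) (cls y)" using t(2) xs ys J0 by (simp add: cdist_cls)
  then have large: "ennreal D < ediam cdist (\<Inter>J\<in>\<I>. nbhd acone cdist \<delta> (cone_F (nths As J)))"
    unfolding cone.less_ediam_iff[OF assms(9)] using xs ys by blast
  have \<I>_props: "\<I> \<noteq> {}" "\<I> \<subseteq> Pow {0..r + 1} - {{}, {0..r + 1}}" "\<Inter>\<I> = {}"
    "\<exists>J\<in>\<I>. card J \<noteq> r + 1"
    using \<I>(1) unfolding \<S>_def by blast+
  have "\<forall>J\<in>\<I>. card J = r + 1"
    using gen[unfolded generic_iff_family, THEN conjunct2, THEN spec[of _ \<I>]]
    by (rule mp) (intro conjI \<I>_props large)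
  then show False using \<I>_props(4) by blast
qed

text \<open>Medians at the constant radius \<beta>, chosen for every \<open>n\<close>, form one
  sequence lying within \<beta> of all faces. Its class therefore lies in each face of the cone
  itself.\<close>

lemma cone_CM1:
  assumes "\<forall>a\<in>tuples (r + 2) M. face_intersection r M d F \<beta> a \<noteq> {}" "0 \<le> \<beta>"
    and "As \<in> tuples (r + 2) acone"
  shows "face_intersection r acone cdist cone_F 0 As \<noteq> {}"
proof -
  define bs where "bs = map rep As"
  have bs: "bs \<in> tuples (r + 2) seqs" using assms(3) by (simp add: bs_def map_rep_tuples)
  have "\<exists>m. m \<in> face_intersection r M d F \<beta> (slice n bs)" for n
    using assms(1) slice_tuples[OF bs] by blast
  then obtain m where m: "\<And>n. m n \<in> face_intersection r M d F \<beta> (slice n bs)" by metis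
  have "cls m \<in> ultralimit (nths bs ({0..r + 1} - {j}))" if j: "j \<in> {0..r + 1}" for j
  proof -
    have "card ({0..r + 1} - {j}) = r + 1" using j by simp
    then have t: "nths bs ({0..r + 1} - {j}) \<in> tuples (r + 1) seqs"
      using tuples_nths[OF bs, of "{0..r + 1} - {j}"] by (auto simp: atLeast0AtMost lessThan_Suc_atMost)
    have sub: "F (slice n (nths bs ({0..r + 1} - {j}))) \<subseteq> M" for n
      using F_subset[OF order_refl slice_tuples[OF t]] .
    have mn: "m n \<in> nbhd M d \<beta> (F (slice n (nths bs ({0..r + 1} - {j}))))" for n
      using m[of n] j by (auto simp: face_intersection_def nths_map)
    have "range m \<subseteq> M" using mn nbhd_subset[OF sub] by blast
    moreover have "\<exists>y\<in>F (slice n (nths bs ({0..r + 1} - {j}))). d (m n) y \<le> \<beta>" for n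
      using nbhdD[OF mn sub assms(2)] by metis
    ultimately show ?thesis by (rule sublinear_near_ultralimit[OF order_refl t])
  qed
  then have "cls m \<in> face_intersection r acone cdist cone_F 0 As"
    by (auto simp: face_intersection_def nbhd_def cone_F_nths bs_def)
  then show ?thesis by blast
qed

text \<open>The error is expressed as \<alpha> times a parameter \<open>e n\<close>, because
  \<alpha> is the slope of \<open>lam\<close>: the limit of \<open>e\<close> can then be compared
  with \<delta> directly.\<close>

lemma near_cone_face:
  assumes As: "As \<in> tuples (r + 2) acone" and j: "j \<in> {0..r + 1}" and \<alpha>: "0 < \<alpha>" and \<delta>: "0 \<le> \<delta>"
    and W: "W \<in> face_intersection r acone cdist cone_F (\<alpha> * \<delta>) As"
  shows "W \<in> acone"
    and "\<exists>e. (\<exists>l. (e \<longlongrightarrow> l) \<omega> \<and> (l < \<delta> \<or> l = 0 \<and> \<delta> = 0)) \<and>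
      (\<forall>n. \<exists>y\<in>F (nths (slice n (map rep As)) ({0..r + 1} - {j})). d (rep W n) y \<le> \<alpha> * e n * \<nu> n)"
proof -
  define bs where "bs = map rep As"
  have bs: "bs \<in> tuples (r + 2) seqs" using As by (simp add: bs_def map_rep_tuples)
  let ?J = "{0..r + 1} - {j}"
  have "card ?J = r + 1" using j by simp
  then have t: "nths bs ?J \<in> tuples (r + 1) seqs"
    using tuples_nths[OF bs, of ?J] by (auto simp: atLeast0AtMost lessThan_Suc_atMost)
  note sub = ultralimit_subset[OF order_refl t]
  have "W \<in> nbhd acone cdist (\<alpha> * \<delta>) (ultralimit (nths bs ?J))"
    using W j by (auto simp: face_intersection_def cone_F_nths bs_def)
  then have "W \<in> acone \<and> (\<exists>Y\<in>ultralimit (nths bs ?J). cdist W Y < \<alpha> * \<delta> \<or> \<alpha> * \<delta> = 0 \<and> W = Y)"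
    using cone.mem_nbhd_iff[OF sub] \<alpha> \<delta> by simp
  then obtain Y where Wc: "W \<in> acone" and Y: "Y \<in> ultralimit (nths bs ?J)"
    "cdist W Y < \<alpha> * \<delta> \<or> \<alpha> * \<delta> = 0 \<and> W = Y" by blast
  show "W \<in> acone" by (fact Wc)
  obtain y where y: "Y = cls y" "\<And>n. y n \<in> F (slice n (nths bs ?J))"
    using Y(1) by (auto simp: ultralimit_def)
  have ys: "y \<in> seqs" using order_refl t y(2) by (rule ultralimit_seqs)
  note ws = rep_in_seqs[OF Wc]
  have dist: "cdist W Y = pdist (rep W) y" using cdist_cls[OF ws ys] cls_rep[OF Wc] y(1) by simp
  define e where "e n = d (rep W n) (y n) / \<nu> n / \<alpha>" for n
  have "(e \<longlongrightarrow> pdist (rep W) y / \<alpha>) \<omega>"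
    unfolding e_def using \<alpha> by (intro tendsto_divide tendsto_pdist ws ys tendsto_const) simp
  moreover have "pdist (rep W) y / \<alpha> < \<delta> \<or> pdist (rep W) y / \<alpha> = 0 \<and> \<delta> = 0"
    using Y(2) \<alpha> Wc by (auto simp: dist[symmetric] divide_less_eq mult.commute)
  moreover have "\<exists>y\<in>F (nths (slice n bs) ?J). d (rep W n) y \<le> \<alpha> * e n * \<nu> n" for n
    using y(2)[of n] \<alpha> scale_pos[of n] by (intro bexI[of _ "y n"]) (auto simp: e_def nths_map)
  ultimately show "\<exists>e. (\<exists>l. (e \<longlongrightarrow> l) \<omega> \<and> (l < \<delta> \<or> l = 0 \<and> \<delta> = 0)) \<and>
      (\<forall>n. \<exists>y\<in>F (nths (slice n (map rep As)) ?J). d (rep W n) y \<le> \<alpha> * e n * \<nu> n)"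
    unfolding bs_def by blast
qed

text \<open>Two points of the intersection of the faces determine a scale \<open>s\<close> with \<open>s n / \<nu> n\<close> tending to some
  \<open>l < \<delta>\<close> (or to 0 if \<open>\<delta> = 0\<close>) at which their representatives lie in the intersection of the faces
  in the space; genericity in the cone at \<open>\<delta>\<close> is what gives genericity at this smaller scale.\<close>

lemma cone_CM2:
  assumes CM2: "\<And>\<delta> D a. \<lbrakk>\<delta>0 \<le> \<delta>; \<delta>0 \<le> D; generic r M d F \<delta> D a\<rbrakk> \<Longrightarrow>
      ediam d (face_intersection r M d F (lam \<delta>) a) \<le> ennreal (\<Psi> \<delta> D)"
    and lam: "\<And>\<delta>. \<delta>0 \<le> \<delta> \<Longrightarrow> lam \<delta> = \<alpha> * (\<delta> - \<delta>0) + \<beta>" "0 < \<alpha>" "0 \<le> \<beta>"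
    and \<Psi>: "\<And>\<delta> D. \<lbrakk>\<delta>0 \<le> \<delta>; \<delta>0 \<le> D\<rbrakk> \<Longrightarrow> 0 \<le> \<Psi> \<delta> D"
      "\<And>\<delta> D. \<lbrakk>\<delta>0 \<le> \<delta>; \<delta>0 \<le> D\<rbrakk> \<Longrightarrow> \<Psi> \<delta> D = B * \<delta> + C * D + E"
    and BC: "0 \<le> B" "0 \<le> C" and \<delta>0: "0 \<le> \<delta>0" and \<delta>D: "0 \<le> \<delta>" "0 \<le> D"
    and gen: "generic r acone cdist cone_F \<delta> D As"
  shows "ediam cdist (face_intersection r acone cdist cone_F (\<alpha> * \<delta>) As) \<le> ennreal (B * \<delta> + C * D)"
proof -
  define bs where "bs = map rep As"
  have As: "As \<in> tuples (r + 2) acone" using gen by (simp add: generic_def)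
  have "cdist U V \<le> B * \<delta> + C * D"
    if U: "U \<in> face_intersection r acone cdist cone_F (\<alpha> * \<delta>) As"
      and V: "V \<in> face_intersection r acone cdist cone_F (\<alpha> * \<delta>) As" for U V
  proof (rule field_le_epsilon)
    \<comment> \<open>The slack pays for a diameter bound whose limit strictly exceeds
      \<open>D\<close>.\<close>
    fix \<eta> :: real assume \<eta>: "0 < \<eta>"
    have UV: "W \<in> face_intersection r acone cdist cone_F (\<alpha> * \<delta>) As" if "W \<in> {U, V}" for W
      using U V that by blast
    have cone: "W \<in> acone" if "W \<in> {U, V}" for W
      using near_cone_face(1)[OF As _ lam(2) \<delta>D(1) UV[OF that], of 0] by simp
    define good where "good P e \<longleftrightarrow> (\<exists>l. (e \<longlongrightarrow> l) \<omega> \<and> (l < \<delta> \<or> l = 0 \<and> \<delta> = 0)) \<and>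
      (\<forall>n. \<exists>y\<in>F (nths (slice n bs) ({0..r + 1} - {snd P})). d (rep (fst P) n) y \<le> \<alpha> * e n * \<nu> n)"
      for P :: "(nat \<Rightarrow> 'a) set \<times> nat" and e
    have "\<forall>P\<in>{U, V} \<times> {0..r + 1}. \<exists>e. good P e"
      unfolding bs_def good_def
      by (intro ballI near_cone_face(2)[OF As _ lam(2) \<delta>D(1) UV]) (auto simp: mem_Times_iff)
    from bchoice[OF this] obtain e where good: "\<forall>P\<in>{U, V} \<times> {0..r + 1}. good P (e P)" ..
    have e: "\<exists>l. (e P \<longlongrightarrow> l) \<omega> \<and> (l < \<delta> \<or> l = 0 \<and> \<delta> = 0)"
      "\<exists>y\<in>F (nths (slice n bs) ({0..r + 1} - {snd P})). d (rep (fst P) n) y \<le> \<alpha> * e P n * \<nu> n"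
      if "P \<in> {U, V} \<times> {0..r + 1}" for P n
      using bspec[OF good that] unfolding good_def by (rule conjunct1, elim conjE, elim allE)
    have "\<exists>g l. (g \<longlongrightarrow> l) \<omega> \<and> (l < \<delta> \<or> l = 0 \<and> \<delta> = 0) \<and> (\<forall>n. 0 \<le> g n) \<and>
        (\<forall>P\<in>{U, V} \<times> {0..r + 1}. \<forall>n. e P n \<le> g n)"
      by (rule finite_dominating_seq[OF _ \<delta>D(1) e(1)]) simp_all
    then obtain g l where g: "(g \<longlongrightarrow> l) \<omega>" "l < \<delta> \<or> l = 0 \<and> \<delta> = 0" "\<And>n. 0 \<le> g n"
        "\<And>P n. P \<in> {U, V} \<times> {0..r + 1} \<Longrightarrow> e P n \<le> g n" by metis
    \<comment> \<open>The summand \<open>\<delta>0\<close> keeps \<open>s n\<close> in the domain of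
      \<open>lam\<close>, and the 1 contributes an extra \<alpha> to \<open>lam (s n)\<close>, which
      makes the inclusion in the open neighbourhood strict. The factor 1 only matches the form of
      \<open>tendsto_affine_over_scale\<close>.\<close>
    define s where "s n = 1 * (g n * \<nu> n) + (\<delta>0 + 1)" for n
    have s_ge: "\<delta>0 \<le> s n" for n using g(3) scale_nonneg by (simp add: s_def)
    have "g n * \<nu> n / \<nu> n = g n" for n using scale_pos[of n] by simp
    then have s_lim: "((\<lambda>n. s n / \<nu> n) \<longlongrightarrow> l) \<omega>"
      using tendsto_affine_over_scale[of "\<lambda>n. g n * \<nu> n" l 1 "\<delta>0 + 1"] g(1) by (simp add: s_def)
    \<comment> \<open>Chosen so that \<open>C * m \<le> C * D + \<eta>\<close>; the denominator
      \<open>C + 1\<close> is positive even when \<open>C = 0\<close>.\<close>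
    define m where "m = D + \<eta> / (C + 1)"
    have m: "D < m" using \<eta> BC(2) by (simp add: m_def)
    define t where "t n = m * \<nu> n + \<delta>0" for n
    have t_ge: "\<delta>0 \<le> t n" for n using m \<delta>D(2) scale_nonneg by (simp add: t_def)
    have t_lim: "((\<lambda>n. t n / \<nu> n) \<longlongrightarrow> m) \<omega>"
    proof -
      have "\<nu> n / \<nu> n = 1" for n using scale_pos[of n] by simp
      then show ?thesis using tendsto_affine_over_scale[of \<nu> 1 m \<delta>0] by (simp add: t_def)
    qed
    have face: "rep W n \<in> face_intersection r M d F (lam (s n)) (slice n bs)" if W: "W \<in> {U, V}" for W n
      unfolding face_intersection_def
    proof
      fix j assume j: "j \<in> {0..r + 1}"
      have P: "(W, j) \<in> {U, V} \<times> {0..r + 1}" using W j by blast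
      obtain y where y: "y \<in> F (nths (slice n bs) ({0..r + 1} - {j}))" "d (rep W n) y \<le> \<alpha> * e (W, j) n * \<nu> n"
        using e(2)[OF P, of n] by auto
      have "\<alpha> * e (W, j) n * \<nu> n \<le> \<alpha> * g n * \<nu> n"
        using g(4)[OF P] lam(2) scale_nonneg by (intro mult_right_mono mult_left_mono) auto
      moreover have "lam (s n) = \<alpha> * g n * \<nu> n + \<alpha> + \<beta>"
        using lam(1)[OF s_ge] by (simp add: s_def algebra_simps)
      ultimately have "d (rep W n) y < lam (s n)" using y(2) lam(2,3) by linarith
      then show "rep W n \<in> nbhd M d (lam (s n)) (F (nths (slice n bs) ({0..r + 1} - {j})))"
        using seqs_in[OF rep_in_seqs[OF cone[OF W]]] y(1) by (rule nbhdI[rotated 2])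
    qed
    have "eventually (\<lambda>n. generic r M d F (s n) (t n) (slice n bs)) \<omega>"
      unfolding bs_def
      by (rule eventually_generic[OF gen s_lim g(2) _ t_lim m _ \<delta>D])
        (use s_ge t_ge \<delta>0 in \<open>blast intro: order_trans\<close>)+
    then have "eventually (\<lambda>n. d (rep U n) (rep V n) \<le> B * s n + (C * t n + E)) \<omega>"
    proof eventually_elim
      case (elim n)
      have "d (rep U n) (rep V n) \<le> \<Psi> (s n) (t n)"
        using CM2[OF s_ge t_ge elim] face unfolding ediam_le_iff[OF \<Psi>(1)[OF s_ge t_ge]] by blast
      then show ?case using \<Psi>(2)[OF s_ge t_ge] by (simp add: add.assoc)
    qed
    \<comment> \<open>Only slopes survive: the offsets in \<open>s\<close> and \<open>t\<close> and
      the constant \<open>E\<close> vanish on division by \<open>\<nu> n\<close>.\<close>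
    moreover have "((\<lambda>n. (B * s n + (C * t n + E)) / \<nu> n) \<longlongrightarrow> B * l + C * m) \<omega>"
      using tendsto_add[OF tendsto_affine_over_scale[OF s_lim, of B 0] tendsto_affine_over_scale[OF t_lim, of C E]]
      by (simp add: add_divide_distrib)
    ultimately have "cdist U V \<le> B * l + C * m"
      using cone by (simp add: cdist_eq pdist_le[OF rep_in_seqs rep_in_seqs])
    also have "B * l \<le> B * \<delta>" using g(2) BC(1) by (intro mult_left_mono) auto
    also have "C * m \<le> C * D + \<eta>"
    proof -
      have "C * (\<eta> / (C + 1)) \<le> \<eta>" using \<eta> BC(2) by (simp add: field_simps)
      then show ?thesis by (simp add: m_def distrib_left)
    qed
    finally show "cdist U V \<le> B * \<delta> + C * D + \<eta>" by simp
  qed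
  then show ?thesis using BC \<delta>D by (subst cone.ediam_le_iff) auto
qed

text \<open>The new parameters are the homogeneous parts of the old ones: the slope \<alpha> of
  \<open>lam\<close>, and \<Psi> without \<open>E\<close>.\<close>

lemma median_structure_cone:
  assumes med: "coarse_median_structure r M d F \<Lambda> \<delta>0 lam \<Psi>" and aff: "affine_in_both \<delta>0 \<Psi>"
  shows "\<exists>\<alpha> B C. median_structure r acone cdist cone_F (\<lambda>R. (Q + 1) * R) 0 (\<lambda>\<delta>. \<alpha> * \<delta>) (\<lambda>\<delta> D. B * \<delta> + C * D)"
proof -
  have \<delta>0: "0 \<le> \<delta>0"
    and \<Psi>: "\<And>\<delta> D. \<lbrakk>\<delta>0 \<le> \<delta>; \<delta>0 \<le> D\<rbrakk> \<Longrightarrow> 0 \<le> \<Psi> \<delta> D"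
      "mono_on {\<delta>0..} (\<lambda>\<delta>. \<Psi> \<delta> \<delta>0)" "mono_on {\<delta>0..} (\<lambda>D. \<Psi> \<delta>0 D)"
    and CM1: "\<forall>a\<in>tuples (r + 2) M. face_intersection r M d F (lam \<delta>0) a \<noteq> {}"
    and CM2: "\<And>\<delta> D a. \<lbrakk>\<delta>0 \<le> \<delta>; \<delta>0 \<le> D; generic r M d F \<delta> D a\<rbrakk> \<Longrightarrow>
      ediam d (face_intersection r M d F (lam \<delta>) a) \<le> ennreal (\<Psi> \<delta> D)"
    using med unfolding coarse_median_structure_def by simp_all
  have "\<exists>\<alpha>>0. \<exists>\<beta>\<ge>0. \<forall>\<delta>\<ge>\<delta>0. lam \<delta> = \<alpha> * (\<delta> - \<delta>0) + \<beta>"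
    using med unfolding coarse_median_structure_def by (elim conjE)
  then obtain \<alpha> \<beta> where lam: "\<And>\<delta>. \<delta>0 \<le> \<delta> \<Longrightarrow> lam \<delta> = \<alpha> * (\<delta> - \<delta>0) + \<beta>" "0 < \<alpha>" "0 \<le> \<beta>"
    by blast
  obtain B C E where aff: "\<And>\<delta> D. \<lbrakk>\<delta>0 \<le> \<delta>; \<delta>0 \<le> D\<rbrakk> \<Longrightarrow> \<Psi> \<delta> D = B * \<delta> + C * D + E"
    using aff unfolding affine_in_both_def by blast
  \<comment> \<open>Comparing \<Psi> at \<open>\<delta>0\<close> and \<open>\<delta>0 + 1\<close>
    isolates one coefficient, whose sign follows from monotonicity.\<close>
  have "0 \<le> B" using mono_onD[OF \<Psi>(2), of \<delta>0 "\<delta>0 + 1"] by (simp add: aff algebra_simps)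
  moreover have "0 \<le> C" using mono_onD[OF \<Psi>(3), of \<delta>0 "\<delta>0 + 1"] by (simp add: aff algebra_simps)
  ultimately have BC: "0 \<le> B" "0 \<le> C" by auto
  have fill: "filling r acone cdist cone_F (\<lambda>R. (Q + 1) * R)" by (rule filling_cone_F)
  have "coarse_median_structure r acone cdist cone_F (\<lambda>R. (Q + 1) * R) 0 (\<lambda>\<delta>. \<alpha> * \<delta>) (\<lambda>\<delta> D. B * \<delta> + C * D)"
    unfolding coarse_median_structure_def
  proof (intro conjI)
    show "Metric_space acone cdist" by (rule cone.Metric_space_axioms)
    show "coarse_filling r acone cdist cone_F (\<lambda>R. (Q + 1) * R)"
      using fill by (simp add: filling_def)
    show "\<exists>\<alpha>'>0. \<exists>\<beta>'\<ge>0. \<forall>\<delta>\<ge>0. \<alpha> * \<delta> = \<alpha>' * (\<delta> - 0) + \<beta>'"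
      using lam(2) by (intro exI[of _ \<alpha>] exI[of _ 0] conjI) auto
    show "\<forall>D\<ge>0. mono_on {0..} (\<lambda>\<delta>. B * \<delta> + C * D)"
      using BC by (auto intro!: mono_onI mult_left_mono)
    show "\<forall>\<delta>\<ge>0. mono_on {0..} (\<lambda>D. B * \<delta> + C * D)"
      using BC by (auto intro!: mono_onI mult_left_mono)
    \<comment> \<open>The radius in (CM1) is \<open>lam \<delta>0 = \<beta>\<close>, a constant that
      rescales to 0.\<close>
    show "\<forall>a\<in>tuples (r + 2) acone. face_intersection r acone cdist cone_F (\<alpha> * 0) a \<noteq> {}"
      using cone_CM1[OF CM1] lam by simp
    show "\<forall>\<delta>\<ge>0. \<forall>D\<ge>0. \<forall>a. generic r acone cdist cone_F \<delta> D a \<longrightarrow>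
        ediam cdist (face_intersection r acone cdist cone_F (\<alpha> * \<delta>) a) \<le> ennreal (B * \<delta> + C * D)"
      using cone_CM2[OF CM2 lam \<Psi>(1) aff BC \<delta>0] by blast
  qed (use BC in auto)
  then have "median_structure r acone cdist cone_F (\<lambda>R. (Q + 1) * R) 0 (\<lambda>\<delta>. \<alpha> * \<delta>) (\<lambda>\<delta> D. B * \<delta> + C * D)"
    unfolding median_structure_def using fill by auto
  then show ?thesis by blast
qed

end

theorem proposition1p13:
  fixes X :: "'a set" and d :: "'a \<Rightarrow> 'a \<Rightarrow> real" and r :: nat
    and F :: "'a list \<Rightarrow> 'a set" and \<Lambda> :: "real \<Rightarrow> real"
    and \<delta>0 :: real and lam :: "real \<Rightarrow> real" and \<Psi> :: "real \<Rightarrow> real \<Rightarrow> real"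
    and \<omega> :: "nat filter" and p :: 'a and \<nu> :: "nat \<Rightarrow> real"
  assumes "r \<ge> 1"
    and "geodesic_space X d"
    and "coarse_median_structure r X d F \<Lambda> \<delta>0 lam \<Psi>"
    and "affine_in_both \<delta>0 \<Psi>"
    and "nonprincipal_ultrafilter \<omega>"
    and "p \<in> X"
    and "\<And>n. \<nu> n > 0"
    and "filterlim \<nu> at_top sequentially"
  shows "\<exists>F' \<Lambda>' \<delta>0' lam' \<Psi>'.
    median_structure r (asymptotic_cone X d \<omega> p \<nu>) (cone_dist X d \<omega> p \<nu>) F' \<Lambda>' \<delta>0' lam' \<Psi>'"
proof -
  interpret Metric_space X d using assms(2) by (simp add: geodesic_space_def)
  have "coarse_filling r X d F \<Lambda>" using assms(3) by (simp add: coarse_median_structure_def)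
  then interpret cone_filling X d \<omega> p \<nu> r F \<Lambda>
    using assms by unfold_locales
  show ?thesis using median_structure_cone[OF assms(3,4)] by blast
qed

end
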